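(* Let $R$ be a Noetherian normal domain of positive Krull dimension whose divisor class group $\operatorname{Cl}(R)=\operatorname{Cl}(\operatorname{Spec}(R))$ is annihilated by an integer $D>0$. Then $$\mathfrak{q}^{(D(r-1)+s)}=(\mathfrak{q}^{(D)})^{r-1}\,\mathfrak{q}^{(s)},\qquad\text{and}\qquad \mathfrak{q}^{(D(r-1)+1)}\subseteq \mathfrak{q}^r$$ for all ideals $\mathfrak{q}\subseteq R$ of pure height one, all integers $r>0$, and all integers $0\le s<D$.
   Context: For a proper ideal $I$ in a nonzero Noetherian ring $R$ and an integer $a>0$, the $a$-th symbolic power is $I^{(a)}=I^aW^{-1}R\cap R=\{f\in R: sf\in I^a\text{ for some }s\in W\}$, where $W=R\setminus\bigcup\{P: P\in\operatorname{Ass}_R(R/I)\}$. By convention $I^{(0)}=R$ (and $I^0=R$). A proper ideal has pure height $h$ if every associated prime of it has height $h$. The divisor class group $\operatorname{Cl}(R)$ of a Noetherian normal domain $R$ is the free abelian group on the set of height one primes of $R$ modulo the relations $a_1P_1+\dots+a_rP_r=0$ whenever the ideal $P_1^{(a_1)}\cap\dots\cap P_r^{(a_r)}$ is principal. *)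

theory Defs
  imports "HOL-Algebra.Algebra" "HOL-Library.Extended_Nat"
begin

section \<open>Height and Krull dimension\<close>

definition prime_chain :: "('a, 'b) ring_scheme \<Rightarrow> nat \<Rightarrow> (nat \<Rightarrow> 'a set) \<Rightarrow> bool" where
  "prime_chain R n C \<longleftrightarrow>
     (\<forall>i\<le>n. primeideal (C i) R) \<and> (\<forall>i<n. C i \<subset> C (Suc i))"

definition height :: "('a, 'b) ring_scheme \<Rightarrow> 'a set \<Rightarrow> enat" where
  "height R P = Sup {enat n | n. \<exists>C. prime_chain R n C \<and> C n = P}"

definition krull_dim :: "('a, 'b) ring_scheme \<Rightarrow> enat" where
  "krull_dim R = Sup {enat n | n. \<exists>C. prime_chain R n C}"

definition height_one_primes :: "('a, 'b) ring_scheme \<Rightarrow> 'a set set" where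
  "height_one_primes R = {P. primeideal P R \<and> height R P = 1}"


section \<open>Associated primes and symbolic powers\<close>

text \<open>The set $\mathrm{Ass}_R(R/I)$: the primes of $R$ that are the annihilator of an element
  $u$ of the $R$-module $R/I$, on which $r \in R$ acts as multiplication by the coset $I + r$.\<close>

definition assoc_primes :: "('a, 'b) ring_scheme \<Rightarrow> 'a set \<Rightarrow> 'a set set" where
  "assoc_primes R I =
     {P. primeideal P R \<and>
         (\<exists>u \<in> carrier (R Quot I).
            P = {r \<in> carrier R. (I +>\<^bsub>R\<^esub> r) \<otimes>\<^bsub>R Quot I\<^esub> u = \<zero>\<^bsub>R Quot I\<^esub>})}"

definition pure_height :: "('a, 'b) ring_scheme \<Rightarrow> 'a set \<Rightarrow> enat \<Rightarrow> bool" where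
  "pure_height R I h \<longleftrightarrow>
     ideal I R \<and> I \<noteq> carrier R \<and> (\<forall>P \<in> assoc_primes R I. height R P = h)"

text \<open>Ordinary powers of ideals are powers in the semiring \<^const>\<open>ideals_set\<close> of all ideals,
  whose unit is the whole ring.\<close>

abbreviation ideal_power :: "('a, 'b) ring_scheme \<Rightarrow> 'a set \<Rightarrow> nat \<Rightarrow> 'a set" where
  "ideal_power R I n \<equiv> I [^]\<^bsub>ideals_set R\<^esub> n"

definition symbolic_power :: "('a, 'b) ring_scheme \<Rightarrow> 'a set \<Rightarrow> nat \<Rightarrow> 'a set" where
  "symbolic_power R I a =
     (if a = 0 then carrier R
      else {f \<in> carrier R. \<exists>s \<in> carrier R - \<Union>(assoc_primes R I). s \<otimes>\<^bsub>R\<^esub> f \<in> ideal_power R I a})"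


section \<open>The field of fractions and normality\<close>

definition frac_rel :: "('a, 'b) ring_scheme \<Rightarrow> (('a \<times> 'a) \<times> ('a \<times> 'a)) set" where
  "frac_rel R =
     {((a, b), (c, d)). a \<in> carrier R \<and> b \<in> carrier R - {\<zero>\<^bsub>R\<^esub>} \<and>
                        c \<in> carrier R \<and> d \<in> carrier R - {\<zero>\<^bsub>R\<^esub>} \<and>
                        a \<otimes>\<^bsub>R\<^esub> d = c \<otimes>\<^bsub>R\<^esub> b}"

text \<open>The fraction $a/b$.\<close>

definition fraction :: "('a, 'b) ring_scheme \<Rightarrow> 'a \<Rightarrow> 'a \<Rightarrow> ('a \<times> 'a) set" where
  "fraction R a b = frac_rel R `` {(a, b)}"

definition fraction_field :: "('a, 'b) ring_scheme \<Rightarrow> ('a \<times> 'a) set ring" where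
  "fraction_field R =
     \<lparr>carrier = (carrier R \<times> (carrier R - {\<zero>\<^bsub>R\<^esub>})) // frac_rel R,
      monoid.mult = (\<lambda>x y. \<Union>(a, b)\<in>x. \<Union>(c, d)\<in>y. fraction R (a \<otimes>\<^bsub>R\<^esub> c) (b \<otimes>\<^bsub>R\<^esub> d)),
      monoid.one = fraction R \<one>\<^bsub>R\<^esub> \<one>\<^bsub>R\<^esub>,
      ring.zero = fraction R \<zero>\<^bsub>R\<^esub> \<one>\<^bsub>R\<^esub>,
      ring.add = (\<lambda>x y. \<Union>(a, b)\<in>x. \<Union>(c, d)\<in>y.
               fraction R ((a \<otimes>\<^bsub>R\<^esub> d) \<oplus>\<^bsub>R\<^esub> (c \<otimes>\<^bsub>R\<^esub> b)) (b \<otimes>\<^bsub>R\<^esub> d))\<rparr>"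

definition frac_embed :: "('a, 'b) ring_scheme \<Rightarrow> 'a \<Rightarrow> ('a \<times> 'a) set" where
  "frac_embed R a = fraction R a \<one>\<^bsub>R\<^esub>"

text \<open>Polynomials over the subring \<open>S\<close> of \<open>K\<close> are lists of coefficients, leading one first.\<close>

definition integral_over :: "('a, 'b) ring_scheme \<Rightarrow> 'a set \<Rightarrow> 'a \<Rightarrow> bool" where
  "integral_over K S x \<longleftrightarrow>
     (\<exists>p \<in> carrier (S[X]\<^bsub>K\<^esub>). p \<noteq> [] \<and> lead_coeff p = \<one>\<^bsub>K\<^esub> \<and> ring.eval K p x = \<zero>\<^bsub>K\<^esub>)"

definition normal_domain :: "('a, 'b) ring_scheme \<Rightarrow> bool" where
  "normal_domain R \<longleftrightarrow> domain R \<and>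
     (\<forall>x \<in> carrier (fraction_field R).
        integral_over (fraction_field R) (frac_embed R ` carrier R) x
          \<longrightarrow> x \<in> frac_embed R ` carrier R)"


section \<open>The divisor class group\<close>

text \<open>The formal sums $a_1 P_1 + \dots + a_r P_r$ of distinct height one primes with positive
  integers $a_i$ for which $P_1^{(a_1)} \cap \dots \cap P_r^{(a_r)}$ is principal. The empty sum
  is included; its intersection is read as \<open>R\<close>.\<close>

definition principal_divisors ::
    "('a, 'b) ring_scheme \<Rightarrow> ('a set \<Rightarrow>\<^sub>0 int) set" where
  "principal_divisors R =
     {c \<in> carrier (free_Abelian_group (height_one_primes R)).
        (\<forall>P \<in> Poly_Mapping.keys c. 0 < Poly_Mapping.lookup c P) \<and>
        principalideal
          (carrier R \<inter> (\<Inter>P \<in> Poly_Mapping.keys c.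
                            symbolic_power R P (nat (Poly_Mapping.lookup c P)))) R}"

text \<open>The group law of \<^const>\<open>free_Abelian_group\<close>, and hence of the quotient, is written
  multiplicatively.\<close>

definition divisor_class_group ::
    "('a, 'b) ring_scheme \<Rightarrow> ('a set \<Rightarrow>\<^sub>0 int) set monoid" where
  "divisor_class_group R =
     free_Abelian_group (height_one_primes R) Mod
       generate (free_Abelian_group (height_one_primes R)) (principal_divisors R)"


section \<open>Basic facts on the field of fractions\<close>

context domain
begin

lemma equiv_frac_rel: "equiv (carrier R \<times> (carrier R - {\<zero>})) (frac_rel R)"
proof (rule equivI)
  show "frac_rel R \<subseteq> (carrier R \<times> (carrier R - {\<zero>})) \<times> (carrier R \<times> (carrier R - {\<zero>}))"
    by (auto simp: frac_rel_def)
  show "refl_on (carrier R \<times> (carrier R - {\<zero>})) (frac_rel R)"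
    by (auto simp: refl_on_def frac_rel_def)
  show "sym (frac_rel R)"
    by (auto simp: sym_def frac_rel_def)
  show "trans (frac_rel R)"
  proof (rule transI, clarsimp simp: frac_rel_def)
    fix a b c d e f
    assume R: "a \<in> carrier R" "b \<in> carrier R" "c \<in> carrier R" "d \<in> carrier R"
        "e \<in> carrier R" "f \<in> carrier R"
      and d: "d \<noteq> \<zero>" and 1: "a \<otimes> d = c \<otimes> b" and 2: "c \<otimes> f = e \<otimes> d"
    have "d \<otimes> (a \<otimes> f) = (a \<otimes> d) \<otimes> f" using R by (simp add: m_ac)
    also have "\<dots> = (c \<otimes> f) \<otimes> b" using R by (simp add: 1 m_ac)
    also have "\<dots> = d \<otimes> (e \<otimes> b)" using R by (simp add: 2 m_ac)
    finally show "a \<otimes> f = e \<otimes> b" using R d m_lcancel by auto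
  qed
qed

lemma frac_eq_iff:
  assumes "a \<in> carrier R" "b \<in> carrier R" "b \<noteq> \<zero>" "c \<in> carrier R" "d \<in> carrier R" "d \<noteq> \<zero>"
  shows "fraction R a b = fraction R c d \<longleftrightarrow> a \<otimes> d = c \<otimes> b"
  using eq_equiv_class_iff[OF equiv_frac_rel, of "(a, b)" "(c, d)"] assms
  by (auto simp: fraction_def frac_rel_def)

lemma frac_closed [simp]:
  assumes "a \<in> carrier R" "b \<in> carrier R" "b \<noteq> \<zero>"
  shows "fraction R a b \<in> carrier (fraction_field R)"
  using assms by (auto simp: fraction_def fraction_field_def intro: quotientI)

lemma frac_cases:
  assumes "x \<in> carrier (fraction_field R)"
  obtains a b where "a \<in> carrier R" "b \<in> carrier R" "b \<noteq> \<zero>" "x = fraction R a b"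
  using assms by (auto simp: fraction_def fraction_field_def elim!: quotientE)

lemma fraction_field_one: "\<one>\<^bsub>fraction_field R\<^esub> = fraction R \<one> \<one>"
  and fraction_field_zero: "\<zero>\<^bsub>fraction_field R\<^esub> = fraction R \<zero> \<one>"
  by (simp_all add: fraction_field_def)

lemma frac_mult:
  assumes "a \<in> carrier R" "b \<in> carrier R" "b \<noteq> \<zero>" "c \<in> carrier R" "d \<in> carrier R" "d \<noteq> \<zero>"
  shows "fraction R a b \<otimes>\<^bsub>fraction_field R\<^esub> fraction R c d = fraction R (a \<otimes> c) (b \<otimes> d)"
proof -
  have *: "fraction R (a' \<otimes> c') (b' \<otimes> d') = fraction R (a \<otimes> c) (b \<otimes> d)"
    if "(a', b') \<in> fraction R a b" "(c', d') \<in> fraction R c d" for a' b' c' d'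
  proof -
    have R: "a' \<in> carrier R" "b' \<in> carrier R" "b' \<noteq> \<zero>" "a \<otimes> b' = a' \<otimes> b"
      "c' \<in> carrier R" "d' \<in> carrier R" "d' \<noteq> \<zero>" "c \<otimes> d' = c' \<otimes> d"
      using that by (auto simp: fraction_def frac_rel_def)
    have "(a' \<otimes> c') \<otimes> (b \<otimes> d) = (a' \<otimes> b) \<otimes> (c' \<otimes> d)"
      using R(1-3,5-7) assms by (simp add: m_ac)
    also have "\<dots> = (a \<otimes> b') \<otimes> (c \<otimes> d')" using R(4,8) by metis
    also have "\<dots> = (a \<otimes> c) \<otimes> (b' \<otimes> d')"
      using R(1-3,5-7) assms by (simp add: m_ac)
    finally show ?thesis using R assms by (simp add: frac_eq_iff integral_iff)
  qed
  have "(a, b) \<in> fraction R a b" "(c, d) \<in> fraction R c d"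
    using assms by (auto simp: fraction_def frac_rel_def)
  with * have "(\<Union>(a', b')\<in>fraction R a b. \<Union>(c', d')\<in>fraction R c d. fraction R (a' \<otimes> c') (b' \<otimes> d'))
      = fraction R (a \<otimes> c) (b \<otimes> d)"
    by fast
  then show ?thesis by (simp add: fraction_field_def)
qed

lemma frac_add:
  assumes "a \<in> carrier R" "b \<in> carrier R" "b \<noteq> \<zero>" "c \<in> carrier R" "d \<in> carrier R" "d \<noteq> \<zero>"
  shows "fraction R a b \<oplus>\<^bsub>fraction_field R\<^esub> fraction R c d = fraction R ((a \<otimes> d) \<oplus> (c \<otimes> b)) (b \<otimes> d)"
proof -
  have *: "fraction R ((a' \<otimes> d') \<oplus> (c' \<otimes> b')) (b' \<otimes> d') = fraction R ((a \<otimes> d) \<oplus> (c \<otimes> b)) (b \<otimes> d)"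
    if "(a', b') \<in> fraction R a b" "(c', d') \<in> fraction R c d" for a' b' c' d'
  proof -
    have R: "a' \<in> carrier R" "b' \<in> carrier R" "b' \<noteq> \<zero>" "a \<otimes> b' = a' \<otimes> b"
      "c' \<in> carrier R" "d' \<in> carrier R" "d' \<noteq> \<zero>" "c \<otimes> d' = c' \<otimes> d"
      using that by (auto simp: fraction_def frac_rel_def)
    have "((a' \<otimes> d') \<oplus> (c' \<otimes> b')) \<otimes> (b \<otimes> d)
        = ((a' \<otimes> b) \<otimes> (d' \<otimes> d)) \<oplus> ((c' \<otimes> d) \<otimes> (b' \<otimes> b))"
      using R(1-3,5-7) assms by (simp add: m_ac l_distr r_distr)
    also have "\<dots> = ((a \<otimes> b') \<otimes> (d' \<otimes> d)) \<oplus> ((c \<otimes> d') \<otimes> (b' \<otimes> b))"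
      using R(4,8) by metis
    also have "\<dots> = ((a \<otimes> d) \<oplus> (c \<otimes> b)) \<otimes> (b' \<otimes> d')"
      using R(1-3,5-7) assms by (simp add: m_ac l_distr r_distr)
    finally show ?thesis using R assms by (simp add: frac_eq_iff integral_iff)
  qed
  have "(a, b) \<in> fraction R a b" "(c, d) \<in> fraction R c d"
    using assms by (auto simp: fraction_def frac_rel_def)
  with * have "(\<Union>(a', b')\<in>fraction R a b. \<Union>(c', d')\<in>fraction R c d.
        fraction R ((a' \<otimes> d') \<oplus> (c' \<otimes> b')) (b' \<otimes> d')) = fraction R ((a \<otimes> d) \<oplus> (c \<otimes> b)) (b \<otimes> d)"
    by fast
  then show ?thesis by (simp add: fraction_field_def)
qed

lemma cring_fraction_field: "cring (fraction_field R)"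
proof (rule cringI)
  show "abelian_group (fraction_field R)"
  proof (rule abelian_groupI)
    fix x y z
    assume xyz: "x \<in> carrier (fraction_field R)" "y \<in> carrier (fraction_field R)"
      "z \<in> carrier (fraction_field R)"
    obtain a b where a: "a \<in> carrier R" "b \<in> carrier R" "b \<noteq> \<zero>" and x: "x = fraction R a b"
      using xyz(1) by (rule frac_cases)
    obtain c d where c: "c \<in> carrier R" "d \<in> carrier R" "d \<noteq> \<zero>" and y: "y = fraction R c d"
      using xyz(2) by (rule frac_cases)
    obtain e f where e: "e \<in> carrier R" "f \<in> carrier R" "f \<noteq> \<zero>" and z: "z = fraction R e f"
      using xyz(3) by (rule frac_cases)
    show "x \<oplus>\<^bsub>fraction_field R\<^esub> y \<in> carrier (fraction_field R)"
      using a c by (simp add: x y frac_add integral_iff)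
    have "((a \<otimes> d) \<oplus> (c \<otimes> b)) \<otimes> f \<oplus> e \<otimes> (b \<otimes> d)
        = a \<otimes> (d \<otimes> f) \<oplus> ((c \<otimes> f) \<oplus> (e \<otimes> d)) \<otimes> b"
      using a(1,2) c(1,2) e(1,2) by (simp add: l_distr r_distr m_ac a_assoc)
    then show "x \<oplus>\<^bsub>fraction_field R\<^esub> y \<oplus>\<^bsub>fraction_field R\<^esub> z = x \<oplus>\<^bsub>fraction_field R\<^esub> (y \<oplus>\<^bsub>fraction_field R\<^esub> z)"
      using a c e by (simp add: x y z frac_add integral_iff m_assoc[of b d f])
    show "x \<oplus>\<^bsub>fraction_field R\<^esub> y = y \<oplus>\<^bsub>fraction_field R\<^esub> x"
      using a c by (simp add: x y frac_add m_comm a_comm)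
    show "\<zero>\<^bsub>fraction_field R\<^esub> \<oplus>\<^bsub>fraction_field R\<^esub> x = x"
      using a by (simp add: x frac_add fraction_field_zero)
    have "fraction R (\<ominus> a) b \<oplus>\<^bsub>fraction_field R\<^esub> x = \<zero>\<^bsub>fraction_field R\<^esub>"
      using a by (simp add: x frac_add fraction_field_zero frac_eq_iff integral_iff l_minus l_neg)
    then show "\<exists>y\<in>carrier (fraction_field R). y \<oplus>\<^bsub>fraction_field R\<^esub> x = \<zero>\<^bsub>fraction_field R\<^esub>"
      using a by (intro bexI[of _ "fraction R (\<ominus> a) b"]) auto
  qed (simp add: fraction_field_zero)
  show "comm_monoid (fraction_field R)"
  proof (rule comm_monoidI)
    fix x y z
    assume xyz: "x \<in> carrier (fraction_field R)" "y \<in> carrier (fraction_field R)"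
      "z \<in> carrier (fraction_field R)"
    obtain a b where a: "a \<in> carrier R" "b \<in> carrier R" "b \<noteq> \<zero>" and x: "x = fraction R a b"
      using xyz(1) by (rule frac_cases)
    obtain c d where c: "c \<in> carrier R" "d \<in> carrier R" "d \<noteq> \<zero>" and y: "y = fraction R c d"
      using xyz(2) by (rule frac_cases)
    obtain e f where e: "e \<in> carrier R" "f \<in> carrier R" "f \<noteq> \<zero>" and z: "z = fraction R e f"
      using xyz(3) by (rule frac_cases)
    show "x \<otimes>\<^bsub>fraction_field R\<^esub> y \<in> carrier (fraction_field R)"
      using a c by (simp add: x y frac_mult integral_iff)
    show "x \<otimes>\<^bsub>fraction_field R\<^esub> y \<otimes>\<^bsub>fraction_field R\<^esub> z = x \<otimes>\<^bsub>fraction_field R\<^esub> (y \<otimes>\<^bsub>fraction_field R\<^esub> z)"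
      using a c e by (simp add: x y z frac_mult integral_iff m_assoc)
    show "x \<otimes>\<^bsub>fraction_field R\<^esub> y = y \<otimes>\<^bsub>fraction_field R\<^esub> x"
      using a c by (simp add: x y frac_mult m_comm)
    show "\<one>\<^bsub>fraction_field R\<^esub> \<otimes>\<^bsub>fraction_field R\<^esub> x = x"
      using a by (simp add: x frac_mult fraction_field_one)
  qed (simp add: fraction_field_one)
  fix x y z
  assume xyz: "x \<in> carrier (fraction_field R)" "y \<in> carrier (fraction_field R)"
    "z \<in> carrier (fraction_field R)"
  obtain a b where a: "a \<in> carrier R" "b \<in> carrier R" "b \<noteq> \<zero>" and x: "x = fraction R a b"
    using xyz(1) by (rule frac_cases)
  obtain c d where c: "c \<in> carrier R" "d \<in> carrier R" "d \<noteq> \<zero>" and y: "y = fraction R c d"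
    using xyz(2) by (rule frac_cases)
  obtain e f where e: "e \<in> carrier R" "f \<in> carrier R" "f \<noteq> \<zero>" and z: "z = fraction R e f"
    using xyz(3) by (rule frac_cases)
  define n m where "n = ((a \<otimes> d) \<oplus> (c \<otimes> b)) \<otimes> e" and "m = (b \<otimes> d) \<otimes> f"
  have nm: "n \<in> carrier R" "m \<in> carrier R" "m \<noteq> \<zero>"
    using a c e by (auto simp: n_def m_def integral_iff)
  have "((a \<otimes> e) \<otimes> (d \<otimes> f)) \<oplus> ((c \<otimes> e) \<otimes> (b \<otimes> f)) = n \<otimes> f"
    and "(b \<otimes> f) \<otimes> (d \<otimes> f) = m \<otimes> f"
    using a(1,2) c(1,2) e(1,2) by (simp_all add: n_def m_def l_distr r_distr m_ac)
  then have "x \<otimes>\<^bsub>fraction_field R\<^esub> z \<oplus>\<^bsub>fraction_field R\<^esub> y \<otimes>\<^bsub>fraction_field R\<^esub> z = fraction R (n \<otimes> f) (m \<otimes> f)"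
    using a c e by (simp add: x y z frac_add frac_mult integral_iff)
  also have "\<dots> = fraction R n m"
    using nm e by (simp add: frac_eq_iff integral_iff m_ac)
  also have "\<dots> = (x \<oplus>\<^bsub>fraction_field R\<^esub> y) \<otimes>\<^bsub>fraction_field R\<^esub> z"
    using a c e by (simp add: x y z frac_add frac_mult integral_iff n_def m_def)
  finally show "(x \<oplus>\<^bsub>fraction_field R\<^esub> y) \<otimes>\<^bsub>fraction_field R\<^esub> z = x \<otimes>\<^bsub>fraction_field R\<^esub> z \<oplus>\<^bsub>fraction_field R\<^esub> y \<otimes>\<^bsub>fraction_field R\<^esub> z" ..
qed

lemma field_fraction_field: "field (fraction_field R)"
proof -
  interpret K: cring "fraction_field R" by (rule cring_fraction_field)
  show ?thesis
  proof (rule K.cring_fieldI2)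
    show "\<zero>\<^bsub>fraction_field R\<^esub> \<noteq> \<one>\<^bsub>fraction_field R\<^esub>"
      by (simp add: fraction_field_zero fraction_field_one frac_eq_iff)
    fix x assume "x \<in> carrier (fraction_field R)" and nz: "x \<noteq> \<zero>\<^bsub>fraction_field R\<^esub>"
    then obtain a b where ab: "a \<in> carrier R" "b \<in> carrier R" "b \<noteq> \<zero>" "x = fraction R a b"
      by (metis frac_cases)
    with nz have "a \<noteq> \<zero>" by (auto simp: fraction_field_zero frac_eq_iff)
    with ab have "x \<otimes>\<^bsub>fraction_field R\<^esub> fraction R b a = \<one>\<^bsub>fraction_field R\<^esub>"
      by (simp add: frac_mult fraction_field_one frac_eq_iff integral_iff m_ac)
    then show "\<exists>y\<in>carrier (fraction_field R).
        x \<otimes>\<^bsub>fraction_field R\<^esub> y = \<one>\<^bsub>fraction_field R\<^esub>"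
      using ab \<open>a \<noteq> \<zero>\<close> by (auto intro!: bexI[of _ "fraction R b a"])
  qed
qed

lemma frac_embed_hom: "frac_embed R \<in> ring_hom R (fraction_field R)"
  by (rule ring_hom_memI)
    (auto simp: frac_embed_def frac_mult frac_add fraction_field_one)

lemma inj_on_frac_embed: "inj_on (frac_embed R) (carrier R)"
  by (auto simp: inj_on_def frac_embed_def frac_eq_iff)

lemma subring_frac_embed: "subring (frac_embed R ` carrier R) (fraction_field R)"
proof -
  interpret K: cring "fraction_field R" by (rule cring_fraction_field)
  interpret h: ring_hom_ring R "fraction_field R" "frac_embed R"
    by (intro ring_hom_ringI2 frac_embed_hom ring_axioms K.ring_axioms)
  show ?thesis by (rule h.img_is_subring[OF carrier_is_subring])
qed

end

end

theory Submission
  imports Defs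
begin

text \<open>Every height one prime $P$ of $R$ defines a discrete valuation, and an element divides
  another if and only if it does so in all these valuations. For $\mathfrak q$ of pure height one, prime avoidance
  gives $\mathfrak q^{(a)} = \{f : v_P(f) \ge a\,e_P \text{ for all } P \in \mathrm{Ass}(R/\mathfrak q)\}$
  with $e_P = v_P(\mathfrak q)$. Since $D$ kills the class of $\sum_P e_P P$, there is $d \in R$
  whose divisor is $\sum_P D e_P P$. Then $\mathfrak q^{(Dm+s)} = d^m \mathfrak q^{(s)}$ for all $m$
  and $s$, and both claims follow because $d \in \mathfrak q^{(D)} \subseteq \mathfrak q = \mathfrak q^{(1)}$.\<close>

section \<open>Associated primes and height one primes\<close>

text \<open>No localisation is ever formed: divisibility in R_P, the contractions of f R_P to R and
  finally the valuation at P are all expressed inside R. The obstacle is that normality is given as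
  integral closedness in the fraction field, while the argument needs two other facts: P R_P is
  principal for P of height one, and R is the intersection of these R_P. Both come from one
  observation. If f is nonzero and the ideal quotient (f : x) is a prime P, then x/f maps P into R;
  it cannot map P into itself, for it would then be integral and hence lie in R. So P is locally
  principal, and a nonzero locally principal prime has height one. Thus neither Krull's principal
  ideal theorem nor primary decomposition enters. A second point concerns d. The vanishing of the
  D-fold class only yields a fraction f/g with the required divisor. This divisor has no negative
  coefficients, so g divides f and d is the quotient.\<close>

lemma (in noetherian_ring) exists_maximal_ideal_of_set:
  assumes "A \<noteq> {}" and "\<And>I. I \<in> A \<Longrightarrow> ideal I R"
  shows "\<exists>M\<in>A. \<forall>J\<in>A. M \<subseteq> J \<longrightarrow> J = M"
proof (rule subset_Zorn)
  fix C assume C: "subset.chain A C"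
  show "\<exists>U\<in>A. \<forall>J\<in>C. J \<subseteq> U"
  proof (cases "C = {}")
    case True
    with assms(1) show ?thesis by auto
  next
    case False
    have "subset.chain {I. ideal I R} C"
      using C assms(2) by (auto simp: subset_chain_def)
    \<comment> \<open>This is the noetherian condition: a nonempty chain of ideals contains its own
      union, so Zorn's lemma applies to any set \<open>A\<close> of ideals.\<close>
    with False have "\<Union>C \<in> C" by (rule ideal_chain_is_trivial)
    with C show ?thesis by (auto simp: subset_chain_def)
  qed
qed

text \<open>The ideal quotient (I : x), that is, the annihilator of the coset of x in R/I.\<close>

definition colon_ideal :: "('a, 'b) ring_scheme \<Rightarrow> 'a set \<Rightarrow> 'a \<Rightarrow> 'a set" where
  "colon_ideal R I x = {r \<in> carrier R. r \<otimes>\<^bsub>R\<^esub> x \<in> I}"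

context cring
begin

lemma ideal_colon_ideal:
  assumes "ideal I R" "x \<in> carrier R"
  shows "ideal (colon_ideal R I x) R"
proof -
  interpret I: ideal I R by fact
  show ?thesis
  proof (rule idealI)
    show "subgroup (colon_ideal R I x) (add_monoid R)"
      using assms(2)
      by unfold_locales
        (auto simp: colon_ideal_def l_distr l_minus simp flip: a_inv_def)
    fix a r assume "a \<in> colon_ideal R I x" and r: "r \<in> carrier R"
    then have a: "a \<in> carrier R" "a \<otimes> x \<in> I" by (auto simp: colon_ideal_def)
    with r have "r \<otimes> (a \<otimes> x) \<in> I" by (simp add: I.I_l_closed)
    with a r assms(2) show "r \<otimes> a \<in> colon_ideal R I x" "a \<otimes> r \<in> colon_ideal R I x"
      by (auto simp: colon_ideal_def m_ac)
  qed (rule ring_axioms)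
qed

lemma subset_colon_ideal:
  assumes "ideal I R" "x \<in> carrier R"
  shows "I \<subseteq> colon_ideal R I x"
  using assms by (auto simp: colon_ideal_def ideal.I_r_closed ideal.Icarr)

lemma colon_ideal_subset_mult:
  assumes "ideal I R" "x \<in> carrier R" "a \<in> carrier R"
  shows "colon_ideal R I x \<subseteq> colon_ideal R I (a \<otimes> x)"
proof
  fix s assume "s \<in> colon_ideal R I x"
  then have s: "s \<in> carrier R" "s \<otimes> x \<in> I" by (auto simp: colon_ideal_def)
  then have "a \<otimes> (s \<otimes> x) \<in> I" using assms by (simp add: ideal.I_l_closed)
  with s assms show "s \<in> colon_ideal R I (a \<otimes> x)"
    by (simp add: colon_ideal_def m_lcomm)
qed

text \<open>Trades cosets in \<open>R Quot I\<close> for representatives, so that associated primes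
  can be handled as ideal quotients within R.\<close>

lemma assoc_primes_iff:
  assumes "ideal I R"
  shows "P \<in> assoc_primes R I \<longleftrightarrow>
    primeideal P R \<and> (\<exists>x\<in>carrier R. P = colon_ideal R I x)"
proof -
  interpret I: ideal I R by fact
  have mem: "I +> y = I \<longleftrightarrow> y \<in> I" if "y \<in> carrier R" for y
    using that I.a_rcos_const I.a_rcos_self by metis
  have "{r \<in> carrier R. (I +> r) \<otimes>\<^bsub>R Quot I\<^esub> (I +> x) = \<zero>\<^bsub>R Quot I\<^esub>} = colon_ideal R I x"
    if "x \<in> carrier R" for x
    unfolding colon_ideal_def
    by (intro Collect_cong conj_cong refl)
      (simp add: FactRing_def I.rcoset_mult_add mem that)
  moreover have "carrier (R Quot I) = (\<lambda>x. I +> x) ` carrier R"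
    by (auto simp: FactRing_def A_RCOSETS_def')
  ultimately show ?thesis by (auto simp: assoc_primes_def)
qed

text \<open>In the domain R/P every nonzero element has annihilator P. Hence the multiplicative set
  in the symbolic powers of P is the complement of P.\<close>

lemma assoc_primes_prime:
  assumes "primeideal P R"
  shows "assoc_primes R P = {P}"
proof -
  interpret P: primeideal P R by fact
  have *: "colon_ideal R P x = (if x \<in> P then carrier R else P)" if "x \<in> carrier R" for x
    using that P.I_prime P.Icarr by (auto simp: colon_ideal_def P.I_l_closed P.I_r_closed)
  have "\<one> \<notin> P" using P.I_notcarr P.one_imp_carrier by blast
  then have "colon_ideal R P \<one> = P" by (simp add: *)
  then have "P \<in> assoc_primes R P"
    using assms assoc_primes_iff[OF P.is_ideal] one_closed by blast
  moreover have "Q = P" if Q: "Q \<in> assoc_primes R P" for Q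
  proof -
    obtain x where "x \<in> carrier R" "Q = colon_ideal R P x" and "primeideal Q R"
      using Q assoc_primes_iff[OF P.is_ideal] by blast
    then show ?thesis using *[of x] primeideal.I_notcarr[of Q R] by (metis)
  qed
  ultimately show ?thesis by blast
qed

end

section \<open>Height one primes as minimal nonzero primes\<close>

context domain
begin

text \<open>The zero ideal of a domain is prime and starts a chain to every nonzero prime.
  Conversely, in a chain of length at least two ending in P, the member just below P contains
  another prime strictly, so it is nonzero.\<close>

lemma height_one_primes_iff:
  "P \<in> height_one_primes R \<longleftrightarrow>
     primeideal P R \<and> P \<noteq> {\<zero>} \<and> (\<forall>Q. primeideal Q R \<longrightarrow> Q \<subseteq> P \<longrightarrow> Q \<noteq> {\<zero>} \<longrightarrow> Q = P)"
  (is "_ \<longleftrightarrow> ?rhs")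
proof (cases "primeideal P R")
  case True
  let ?S = "{enat n | n. \<exists>C. prime_chain R n C \<and> C n = P}"
  have zero: "\<zero> \<in> Q" if "primeideal Q R" for Q
    using that by (simp add: primeideal.axioms(1) ideal.axioms(1) additive_subgroup.zero_closed)
  have "height R P = 1 \<longleftrightarrow> ?rhs"
  proof
    assume h: "height R P = 1"
    have le: "n \<le> 1" if "prime_chain R n C" "C n = P" for n C
    proof -
      have "enat n \<le> Sup ?S" using that by (intro Sup_upper) auto
      with h show ?thesis by (simp add: height_def one_enat_def)
    qed
    have "P \<noteq> {\<zero>}"
    proof
      assume P: "P = {\<zero>}"
      have "n = 0" if "prime_chain R n C" "C n = P" for n C
      proof (rule ccontr)
        assume "n \<noteq> 0"
        then obtain m where "n = Suc m" by (cases n) auto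
        with that have "primeideal (C m) R" "C m \<subset> P" by (auto simp: prime_chain_def)
        with zero[of "C m"] show False by (auto simp: P)
      qed
      then have "Sup ?S \<le> 0" by (intro Sup_least) (auto simp: zero_enat_def)
      with h show False by (simp add: height_def)
    qed
    moreover have "Q = P" if "primeideal Q R" "Q \<subseteq> P" "Q \<noteq> {\<zero>}" for Q
    proof (rule ccontr)
      assume "Q \<noteq> P"
      have "prime_chain R 2 (\<lambda>i. if i = 0 then {\<zero>} else if i = 1 then Q else P)"
        using that \<open>Q \<noteq> P\<close> True zeroprimeideal zero[of Q]
        by (auto simp: prime_chain_def less_2_cases_iff)
      from le[OF this] show False by simp
    qed
    ultimately show ?rhs using True by blast
  next
    assume rhs: ?rhs
    have "n \<le> 1" if "prime_chain R n C" "C n = P" for n C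
    proof (rule ccontr)
      assume "\<not> n \<le> 1"
      then obtain m where n: "n = Suc (Suc m)" by (metis One_nat_def Suc_leI not_less_eq_eq old.nat.exhaust zero_le)
      with that have C: "primeideal (C m) R" "primeideal (C (Suc m)) R" "C m \<subset> C (Suc m)"
        "C (Suc m) \<subset> P"
        by (auto simp: prime_chain_def)
      have "C (Suc m) \<noteq> {\<zero>}" using zero[OF C(1)] C(3) by auto
      with rhs C(2,4) show False by (metis psubset_eq)
    qed
    then have "Sup ?S \<le> 1" by (intro Sup_least) (auto simp: one_enat_def)
    moreover have "prime_chain R 1 (\<lambda>i. if i = 0 then {\<zero>} else P)"
      using rhs zeroprimeideal zero[of P] by (auto simp: prime_chain_def)
    then have "1 \<le> Sup ?S" by (intro Sup_upper) (force simp: one_enat_def)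
    ultimately show "height R P = 1" by (simp add: height_def)
  qed
  with True show ?thesis by (auto simp: height_one_primes_def)
qed (auto simp: height_one_primes_def)

end

section \<open>Prime ideal quotients and finiteness of minimal primes\<close>

context noetherian_domain
begin

text \<open>The classical argument that a maximal annihilator is prime, carried out relative to a
  multiplicative set \<open>T\<close>: take (I : rx) maximal among those disjoint from
  \<open>T\<close>. Maximality first shows that elements of \<open>T\<close> can be cancelled
  (\<open>sat\<close>), and this replaces passing to the ring of fractions at \<open>T\<close>. With
  \<open>T\<close> = {1} it gives associated primes; with \<open>T\<close> the complement of a prime
  it gives one inside that prime.\<close>

lemma exists_prime_colon_ideal:
  assumes I: "ideal I R" and x: "x \<in> carrier R"
    and T: "T \<subseteq> carrier R" "\<one> \<in> T" "\<And>s t. s \<in> T \<Longrightarrow> t \<in> T \<Longrightarrow> s \<otimes> t \<in> T"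
    and disj: "colon_ideal R I x \<inter> T = {}"
  shows "\<exists>r\<in>carrier R. primeideal (colon_ideal R I (r \<otimes> x)) R \<and>
    colon_ideal R I (r \<otimes> x) \<inter> T = {}"
proof -
  interpret I: ideal I R by fact
  let ?C = "\<lambda>r. colon_ideal R I (r \<otimes> x)"
  let ?A = "{?C r | r. r \<in> carrier R \<and> ?C r \<inter> T = {}}"
  have "?C \<one> \<in> ?A" using disj x by (intro CollectI exI[of _ \<one>]) simp
  then have ne: "?A \<noteq> {}" by blast
  have ideals: "ideal J R" if "J \<in> ?A" for J
    using that ideal_colon_ideal[OF I m_closed[OF _ x]] by blast
  obtain M where M: "M \<in> ?A" and max: "\<forall>J\<in>?A. M \<subseteq> J \<longrightarrow> J = M"
    using exists_maximal_ideal_of_set[OF ne ideals] by (rule bexE)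
  from M obtain r where r: "r \<in> carrier R" and Mr: "M = ?C r" and MT: "?C r \<inter> T = {}" by blast
  have eq: "?C (a \<otimes> r) = ?C r" if "a \<in> carrier R" "?C (a \<otimes> r) \<inter> T = {}" for a
  proof -
    have "?C r \<subseteq> ?C (a \<otimes> r)"
      using colon_ideal_subset_mult[OF I, of "r \<otimes> x" a] that(1) r x by (simp add: m_assoc)
    moreover have "?C (a \<otimes> r) \<in> ?A" using that r by blast
    ultimately show ?thesis using max by (simp add: Mr)
  qed
  have sat: "a \<in> ?C r" if "s \<in> T" "a \<in> carrier R" "s \<otimes> a \<in> ?C r" for a s
  proof -
    have s: "s \<in> carrier R" using that T by auto
    have "?C (s \<otimes> r) \<inter> T = {}"
    proof (rule ccontr)
      assume "?C (s \<otimes> r) \<inter> T \<noteq> {}"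
      then obtain t where t: "t \<in> T" "t \<otimes> (s \<otimes> r \<otimes> x) \<in> I" by (auto simp: colon_ideal_def)
      then have "t \<otimes> s \<in> ?C r \<inter> T"
        using T(3)[OF t(1) \<open>s \<in> T\<close>] s r x T(1) by (auto simp: colon_ideal_def m_assoc subset_iff)
      with MT show False by blast
    qed
    with s have "?C (s \<otimes> r) = ?C r" by (rule eq)
    moreover have "a \<in> ?C (s \<otimes> r)" using that s r x by (simp add: colon_ideal_def m_ac)
    ultimately show ?thesis by blast
  qed
  have "primeideal (?C r) R"
  proof (rule primeidealI)
    show "ideal (?C r) R" by (intro ideal_colon_ideal I) (simp add: r x)
    show "carrier R \<noteq> ?C r" using MT T(2) by blast
    fix a b assume ab: "a \<in> carrier R" "b \<in> carrier R" "a \<otimes> b \<in> ?C r"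
    show "a \<in> ?C r \<or> b \<in> ?C r"
    proof (rule disjCI)
      assume "b \<notin> ?C r"
      have "?C (b \<otimes> r) \<inter> T = {}"
      proof (rule ccontr)
        assume "?C (b \<otimes> r) \<inter> T \<noteq> {}"
        then obtain t where t: "t \<in> T" "t \<otimes> (b \<otimes> r \<otimes> x) \<in> I" by (auto simp: colon_ideal_def)
        then have "t \<otimes> b \<in> ?C r"
          using T(1) r x ab by (auto simp: colon_ideal_def m_assoc subset_iff)
        with sat t(1) ab(2) \<open>b \<notin> ?C r\<close> show False by blast
      qed
      with ab(2) have "?C (b \<otimes> r) = ?C r" by (rule eq)
      moreover have "a \<in> ?C (b \<otimes> r)" using ab r x by (simp add: colon_ideal_def m_ac)
      ultimately show "a \<in> ?C r" by blast
    qed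
  qed (rule is_cring)
  with r MT show ?thesis by blast
qed

text \<open>The case \<open>T\<close> = {1}, where disjointness from \<open>T\<close> just says that
  the ideal quotient is proper, i.e. that x is not in I.\<close>

lemma exists_assoc_prime:
  assumes I: "ideal I R" and x: "x \<in> carrier R" "x \<notin> I"
  obtains P r where "r \<in> carrier R" "P \<in> assoc_primes R I" "P = colon_ideal R I (r \<otimes> x)"
    "colon_ideal R I x \<subseteq> P"
proof -
  interpret I: ideal I R by fact
  obtain r where r: "r \<in> carrier R" "primeideal (colon_ideal R I (r \<otimes> x)) R"
    using exists_prime_colon_ideal[OF I x(1), of "{\<one>}"] x(2) by (auto simp: colon_ideal_def x(1))
  moreover have "colon_ideal R I x \<subseteq> colon_ideal R I (r \<otimes> x)"
    using r(1) x(1) by (intro colon_ideal_subset_mult I)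
  ultimately show thesis
    using that[OF r(1) _ refl] r x(1) assoc_primes_iff[OF I] m_closed by blast
qed

text \<open>Noetherian induction. A maximal counterexample M is neither prime nor the whole ring, so
  it contains a product ab with a and b outside M. Every prime over M contains a or b, so the finite
  sets found for M + (a) and M + (b) together serve M. The set may contain primes that are not
  minimal.\<close>

lemma finite_minimal_primes:
  assumes "ideal I R"
  obtains F where "finite F" "\<And>Q. Q \<in> F \<Longrightarrow> primeideal Q R" "\<And>Q. Q \<in> F \<Longrightarrow> I \<subseteq> Q"
    "\<And>P. primeideal P R \<Longrightarrow> I \<subseteq> P \<Longrightarrow> \<exists>Q\<in>F. Q \<subseteq> P"
proof -
  define fin where "fin J F \<longleftrightarrow> finite F \<and> (\<forall>Q\<in>F. primeideal Q R \<and> J \<subseteq> Q) \<and>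
    (\<forall>P. primeideal P R \<longrightarrow> J \<subseteq> P \<longrightarrow> (\<exists>Q\<in>F. Q \<subseteq> P))" for J F
  have "\<exists>F. fin I F"
  proof (rule ccontr)
    let ?A = "{J. ideal J R \<and> (\<forall>F. \<not> fin J F)}"
    assume "\<nexists>F. fin I F"
    with assms have ne: "?A \<noteq> {}" by auto
    have ideals: "ideal J R" if "J \<in> ?A" for J
      using that by simp
    obtain M where M: "M \<in> ?A" and max: "\<forall>J\<in>?A. M \<subseteq> J \<longrightarrow> J = M"
      using exists_maximal_ideal_of_set[OF ne ideals] by (rule bexE)
    interpret M: ideal M R using M by blast
    have "\<not> primeideal M R"
    proof
      assume "primeideal M R"
      then have "fin M {M}" by (simp add: fin_def)
      with M show False by blast
    qed
    moreover have "carrier R \<noteq> M"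
    proof
      assume carr: "carrier R = M"
      have "\<not> M \<subseteq> P" if "primeideal P R" for P
      proof -
        interpret P: primeideal P R by fact
        show ?thesis using P.I_notcarr P.a_subset carr by blast
      qed
      then have "fin M {}" by (simp add: fin_def)
      with M show False by blast
    qed
    ultimately obtain a b where ab: "a \<in> carrier R" "b \<in> carrier R" "a \<otimes> b \<in> M" "a \<notin> M" "b \<notin> M"
      using primeidealI[OF M.is_ideal is_cring] by blast
    have larger: "\<exists>F. fin (set_add R M (PIdl c)) F" and sub: "M \<subseteq> set_add R M (PIdl c)"
      if c: "c \<in> carrier R" "c \<notin> M" for c
    proof -
      have id: "ideal (PIdl c) R" by (rule cgenideal_ideal[OF c(1)])
      then interpret C: ideal "PIdl c" R .
      have "m \<oplus> \<zero> \<in> set_add R M (PIdl c)" if "m \<in> M" for m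
        using that C.zero_closed unfolding set_add_def' by blast
      then show "M \<subseteq> set_add R M (PIdl c)" using M.Icarr by auto
      moreover have "\<zero> \<oplus> c \<in> set_add R M (PIdl c)"
        using M.zero_closed cgenideal_self[OF c(1)] unfolding set_add_def' by blast
      then have "c \<in> set_add R M (PIdl c)" using c by simp
      then have "set_add R M (PIdl c) \<noteq> M" using c(2) by blast
      ultimately show "\<exists>F. fin (set_add R M (PIdl c)) F"
        using max add_ideals[OF M.is_ideal id] by blast
    qed
    obtain F where F: "fin (set_add R M (PIdl a)) F" using larger[OF ab(1,4)] by blast
    obtain G where G: "fin (set_add R M (PIdl b)) G" using larger[OF ab(2,5)] by blast
    have le: "set_add R M (PIdl c) \<subseteq> P" if "primeideal P R" "M \<subseteq> P" "c \<in> P" for P c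
    proof -
      interpret P: primeideal P R by fact
      show ?thesis using that(2,3) by (auto simp: set_add_def' cgenideal_def P.I_l_closed)
    qed
    have FG: "primeideal Q R \<and> M \<subseteq> Q" if "Q \<in> F \<union> G" for Q
    proof -
      have "primeideal Q R \<and> set_add R M (PIdl a) \<subseteq> Q" if "Q \<in> F"
        using that F by (simp add: fin_def)
      moreover have "primeideal Q R \<and> set_add R M (PIdl b) \<subseteq> Q" if "Q \<in> G"
        using that G by (simp add: fin_def)
      ultimately show ?thesis using that sub[OF ab(1,4)] sub[OF ab(2,5)] by (metis UnE subset_trans)
    qed
    have "fin M (F \<union> G)"
      unfolding fin_def
    proof (intro conjI ballI allI impI)
      fix P assume P: "primeideal P R" "M \<subseteq> P"
      then have "a \<in> P \<or> b \<in> P" using ab primeideal.I_prime[OF P(1)] by blast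
      then show "\<exists>Q\<in>F \<union> G. Q \<subseteq> P"
      proof
        assume "a \<in> P"
        with le P F show ?thesis unfolding fin_def by blast
      next
        assume "b \<in> P"
        with le P G show ?thesis unfolding fin_def by blast
      qed
    qed (use F G FG in \<open>simp_all add: fin_def\<close>)
    with M show False by blast
  qed
  with that show thesis unfolding fin_def by blast
qed

text \<open>Such a P contains a member of the finite set attached to (f). That member contains f, so
  it is nonzero, and by minimality it equals P.\<close>

lemma finite_height_one_primes_containing:
  assumes "f \<in> carrier R" "f \<noteq> \<zero>"
  shows "finite {P \<in> height_one_primes R. f \<in> P}"
proof -
  obtain F where F: "finite F" "\<And>Q. Q \<in> F \<Longrightarrow> primeideal Q R" "\<And>Q. Q \<in> F \<Longrightarrow> PIdl f \<subseteq> Q"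
    "\<And>P. primeideal P R \<Longrightarrow> PIdl f \<subseteq> P \<Longrightarrow> \<exists>Q\<in>F. Q \<subseteq> P"
    using finite_minimal_primes[OF cgenideal_ideal[OF assms(1)]] by metis
  have "P \<in> F" if P: "P \<in> height_one_primes R" "f \<in> P" for P
  proof -
    from P have "primeideal P R" by (simp add: height_one_primes_iff)
    then have "PIdl f \<subseteq> P" using P(2) cgenideal_minimal primeideal.axioms(1) by blast
    with \<open>primeideal P R\<close> F(4) obtain Q where Q: "Q \<in> F" "Q \<subseteq> P" by blast
    with F(2,3) have "f \<in> Q" "primeideal Q R" using cgenideal_self[OF assms(1)] by auto
    with Q P assms(2) show ?thesis by (auto simp: height_one_primes_iff)
  qed
  with F(1) show ?thesis by (auto intro: finite_subset)
qed

end

section \<open>Height one primes of a normal domain are locally principal\<close>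

context noetherian_domain
begin

text \<open>If $x/f$ keeps a nonzero element of $R$ inside $R$ under all its powers, then it is integral:
  the ideals $(w_0, \dots, w_{n-1})$ with $w_i = w_0 (x/f)^i$ stabilise, and this yields a
  monic equation without determinants.\<close>

lemma almost_integral_imp_divides:
  assumes normal: "normal_domain R"
    and fx: "f \<in> carrier R" "f \<noteq> \<zero>" "x \<in> carrier R"
    and w: "\<And>n. w n \<in> carrier R" "w 0 \<noteq> \<zero>" "\<And>n. w (Suc n) \<otimes> f = w n \<otimes> x"
  shows "x \<in> PIdl f"
proof -
  let ?K = "fraction_field R" and ?h = "frac_embed R"
  interpret K: field ?K by (rule field_fraction_field)
  interpret h: ring_hom_cring R ?K ?h
    by (intro ring_hom_cringI ring_hom_ringI2 frac_embed_hom ring_axioms K.ring_axioms is_cring K.is_cring)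
  define y where "y = fraction R x f"
  have y: "y \<in> carrier ?K" using fx by (simp add: y_def)
  have hw: "?h (w n) = ?h (w 0) \<otimes>\<^bsub>?K\<^esub> y [^]\<^bsub>?K\<^esub> n" for n
  proof (induction n)
    case 0
    then show ?case using w by simp
  next
    case (Suc n)
    have "?h (w (Suc n)) = ?h (w n) \<otimes>\<^bsub>?K\<^esub> y"
      using w fx by (simp add: frac_embed_def y_def frac_mult frac_eq_iff)
    then show ?case using Suc w y by (simp add: K.m_assoc)
  qed
  define J where "J = rec_nat {\<zero>} (\<lambda>n I. set_add R I (PIdl (w n)))"
  have J_simps: "J 0 = {\<zero>}" "\<And>n. J (Suc n) = set_add R (J n) (PIdl (w n))"
    by (simp_all add: J_def)
  have idJ: "ideal (J n) R" for n
    by (induction n) (simp_all add: J_simps zeroideal add_ideals cgenideal_ideal w)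
  \<comment> \<open>\<open>J n\<close> is generated by the first n terms of the sequence, so its
    elements are w_0 times polynomials in y of degree below n. The list has length exactly n,
    leading zeros allowed, so that a further leading entry becomes the coefficient of y^n.\<close>
  have rep: "\<exists>q. set q \<subseteq> ?h ` carrier R \<and> length q = n \<and> ?h z = ?h (w 0) \<otimes>\<^bsub>?K\<^esub> K.eval q y"
    if "z \<in> J n" for n z
    using that
  proof (induction n arbitrary: z)
    case 0
    then have "?h z = ?h (w 0) \<otimes>\<^bsub>?K\<^esub> K.eval [] y" using w by (simp add: J_simps)
    then show ?case by (intro exI[of _ "[]"]) simp
  next
    case (Suc n)
    then obtain z' r where z: "z' \<in> J n" "r \<in> carrier R" "z = z' \<oplus> r \<otimes> w n"
      by (auto simp: J_simps set_add_def' cgenideal_def)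
    from Suc.IH[OF z(1)] obtain q where q: "set q \<subseteq> ?h ` carrier R" "length q = n"
      "?h z' = ?h (w 0) \<otimes>\<^bsub>?K\<^esub> K.eval q y" by blast
    have qc: "set q \<subseteq> carrier ?K" using q(1) by auto
    have z': "z' \<in> carrier R" using idJ[of n] z(1) by (rule ideal.Icarr)
    have "?h z = ?h z' \<oplus>\<^bsub>?K\<^esub> ?h r \<otimes>\<^bsub>?K\<^esub> ?h (w n)" using z z' w by simp
    also have "\<dots> = ?h (w 0) \<otimes>\<^bsub>?K\<^esub> K.eval (?h r # q) y"
      using q(2) z(2) w y K.eval_in_carrier[OF qc y]
      by (simp add: q(3) hw[of n] K.r_distr K.a_comm K.m_lcomm)
    finally show ?case using q z(2)
      by (intro exI[of _ "?h r # q"]) auto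
  qed
  have "\<exists>M\<in>range J. \<forall>I\<in>range J. M \<subseteq> I \<longrightarrow> I = M"
    by (rule exists_maximal_ideal_of_set) (use idJ in auto)
  then obtain n where "\<forall>I\<in>range J. J n \<subseteq> I \<longrightarrow> I = J n" by (auto elim!: bexE)
  then have n: "J m = J n" if "J n \<subseteq> J m" for m using that by simp
  interpret P: ideal "PIdl (w n)" R by (rule cgenideal_ideal) (rule w)
  interpret J: ideal "J n" R by (rule idJ)
  have "z \<oplus> \<zero> \<in> J (Suc n)" if "z \<in> J n" for z
    using that P.zero_closed unfolding J_simps set_add_def' by blast
  then have "J n \<subseteq> J (Suc n)" using J.Icarr by auto
  then have "J (Suc n) = J n" by (rule n)
  moreover have "\<zero> \<oplus> w n \<in> J (Suc n)"
    using J.zero_closed cgenideal_self[OF w(1)] unfolding J_simps set_add_def' by blast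
  \<comment> \<open>The sign is chosen so that adding w_n = w_0 y^n gives zero; cancelling w_0 then
    leaves a monic equation for y.\<close>
  ultimately have "\<ominus> w n \<in> J n" using w by auto
  from rep[OF this] obtain q where q: "set q \<subseteq> ?h ` carrier R" "length q = n"
    "?h (\<ominus> w n) = ?h (w 0) \<otimes>\<^bsub>?K\<^esub> K.eval q y" by blast
  have qc: "K.eval q y \<in> carrier ?K" by (rule K.eval_in_carrier) (use q(1) y in auto)
  have h0: "?h (w 0) \<noteq> \<zero>\<^bsub>?K\<^esub>"
    using w(1)[of 0] w(2) by (simp add: frac_embed_def fraction_field_zero frac_eq_iff)
  have "?h (w 0) \<otimes>\<^bsub>?K\<^esub> K.eval (\<one>\<^bsub>?K\<^esub> # q) y = ?h (w n) \<oplus>\<^bsub>?K\<^esub> ?h (\<ominus> w n)"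
    using q(2) w y qc by (simp add: q(3) hw[of n] K.r_distr)
  also have "\<dots> = \<zero>\<^bsub>?K\<^esub>" using w by (simp add: K.r_neg)
  finally have "K.eval (\<one>\<^bsub>?K\<^esub> # q) y = \<zero>\<^bsub>?K\<^esub>"
    using h0 w K.integral_iff q(2) y qc by auto
  moreover have "\<one>\<^bsub>?K\<^esub> # q \<in> carrier ((?h ` carrier R)[X]\<^bsub>?K\<^esub>)"
    using q(1) subringE(3)[OF subring_frac_embed]
    by (simp add: univ_poly_def polynomial_def)
  ultimately have "integral_over ?K (?h ` carrier R) y"
    unfolding integral_over_def by (intro bexI[of _ "\<one>\<^bsub>?K\<^esub> # q"]) simp_all
  with normal y have "y \<in> ?h ` carrier R" by (simp add: normal_domain_def)
  then obtain r where r: "r \<in> carrier R" "fraction R x f = fraction R r \<one>"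
    by (auto simp: y_def frac_embed_def)
  then have "x = r \<otimes> f" using fx by (simp add: frac_eq_iff)
  with r(1) show ?thesis unfolding cgenideal_def by blast
qed

end

text \<open>A nonzero generator of the maximal ideal P R_P that lies in P. The element u is a common
  denominator for all quotients p/t.\<close>

definition uniformizer :: "('a, 'b) ring_scheme \<Rightarrow> 'a set \<Rightarrow> 'a \<Rightarrow> bool" where
  "uniformizer R P t \<longleftrightarrow> t \<in> P \<and> t \<noteq> \<zero>\<^bsub>R\<^esub> \<and>
     (\<exists>u\<in>carrier R - P. \<forall>p\<in>P. \<exists>r\<in>carrier R. u \<otimes>\<^bsub>R\<^esub> p = r \<otimes>\<^bsub>R\<^esub> t)"

context noetherian_domain
begin

text \<open>Let y = x/f, so that yP lies in R. If yP were contained in P, all f y^n would lie in R,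
  so y would be integral, hence in R, and P would contain 1. So some t in P has yt = u outside P.
  For p in P the element w = yp is in R and up = wt, so t generates P locally.\<close>

lemma exists_uniformizer_colon_ideal:
  assumes normal: "normal_domain R"
    and fx: "f \<in> carrier R" "f \<noteq> \<zero>" "x \<in> carrier R"
    and prime: "primeideal P R" and P: "P = colon_ideal R (PIdl f) x"
  shows "\<exists>t. uniformizer R P t"
proof -
  interpret P: primeideal P R by fact
  have memP: "p \<in> P \<longleftrightarrow> p \<in> carrier R \<and> (\<exists>w\<in>carrier R. p \<otimes> x = w \<otimes> f)" for p
    unfolding P colon_ideal_def cgenideal_def by blast
  have fP: "f \<in> P" using fx memP[of f] m_comm by blast
  have "\<exists>p\<in>P. \<exists>w\<in>carrier R - P. p \<otimes> x = w \<otimes> f"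
  proof (rule ccontr)
    assume not: "\<not> ?thesis"
    have ex: "\<exists>w. w \<in> P \<and> w \<otimes> f = p \<otimes> x" if "p \<in> P" for p
    proof -
      from that obtain w where "w \<in> carrier R" "p \<otimes> x = w \<otimes> f" using memP by blast
      with not that show ?thesis by auto
    qed
    \<comment> \<open>Multiplication by x/f on P. Iterated from f, which lies in P, it produces the
      sequence f (x/f)^n.\<close>
    define step where "step p = (SOME w. w \<in> P \<and> w \<otimes> f = p \<otimes> x)" for p
    have step: "step p \<in> P \<and> step p \<otimes> f = p \<otimes> x" if "p \<in> P" for p
      unfolding step_def using ex[OF that] by (rule someI_ex)
    define w where "w = rec_nat f (\<lambda>_. step)"
    have wP: "w n \<in> P" for n
      by (induction n) (use step fP in \<open>auto simp: w_def\<close>)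
    have "x \<in> PIdl f"
    proof (rule almost_integral_imp_divides[OF normal fx])
      show "w n \<in> carrier R" for n using wP P.Icarr by blast
      show "w 0 \<noteq> \<zero>" using fx by (simp add: w_def)
      show "w (Suc n) \<otimes> f = w n \<otimes> x" for n using step[OF wP[of n]] by (simp add: w_def)
    qed
    then obtain r where "r \<in> carrier R" "x = r \<otimes> f" unfolding cgenideal_def by blast
    then have "\<one> \<in> P" using fx memP[of \<one>] by auto
    then show False using P.I_notcarr P.one_imp_carrier by blast
  qed
  then obtain t u where t: "t \<in> P" and u: "u \<in> carrier R" "u \<notin> P" and tu: "t \<otimes> x = u \<otimes> f"
    by blast
  have tc: "t \<in> carrier R" using t by (rule P.Icarr)
  have "t \<noteq> \<zero>"
  proof
    assume "t = \<zero>"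
    with tu fx u have "u = \<zero>" using integral_iff by auto
    with u P.zero_closed show False by simp
  qed
  moreover have "\<exists>r\<in>carrier R. u \<otimes> p = r \<otimes> t" if "p \<in> P" for p
  proof -
    from that obtain w where w: "p \<in> carrier R" "w \<in> carrier R" "p \<otimes> x = w \<otimes> f"
      using memP by blast
    have "f \<otimes> (u \<otimes> p) = p \<otimes> (u \<otimes> f)" using w u fx by (simp add: m_ac)
    also have "\<dots> = p \<otimes> (t \<otimes> x)" by (simp only: tu)
    also have "\<dots> = t \<otimes> (p \<otimes> x)" using w(1) tc fx by (simp add: m_lcomm)
    also have "\<dots> = f \<otimes> (w \<otimes> t)" unfolding w(3) using w(1,2) tc fx by (simp add: m_ac)
    finally have "u \<otimes> p = w \<otimes> t" using w u tc fx m_lcancel by auto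
    with w show ?thesis by blast
  qed
  ultimately show ?thesis using t u unfolding uniformizer_def by blast
qed

end

text \<open>Divisibility in the localisation $R_P$, phrased inside $R$.\<close>

definition local_dvd :: "('a, 'b) ring_scheme \<Rightarrow> 'a set \<Rightarrow> 'a \<Rightarrow> 'a \<Rightarrow> bool" where
  "local_dvd R P f g \<longleftrightarrow> (\<exists>s\<in>carrier R - P. \<exists>r\<in>carrier R. s \<otimes>\<^bsub>R\<^esub> g = r \<otimes>\<^bsub>R\<^esub> f)"

lemma uniformizer_local_dvd:
  assumes "uniformizer R P t" "p \<in> P"
  shows "local_dvd R P t p"
  using assms unfolding uniformizer_def local_dvd_def by blast

section \<open>Arithmetic of divisibility in the localisation at a prime\<close>

lemma (in primeideal) compl_mult:
  "s \<in> carrier R - I \<Longrightarrow> t \<in> carrier R - I \<Longrightarrow> s \<otimes> t \<in> carrier R - I"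
  using I_prime by auto

lemma (in primeideal) one_notin: "\<one> \<notin> I"
  using I_notcarr one_imp_carrier by blast

lemma (in primeideal) local_dvdI:
  "s \<in> carrier R \<Longrightarrow> s \<notin> I \<Longrightarrow> r \<in> carrier R \<Longrightarrow> s \<otimes> g = r \<otimes> f \<Longrightarrow> local_dvd R I f g"
  by (auto simp: local_dvd_def)

lemma (in primeideal) local_dvd_trans:
  assumes "local_dvd R I f g" "local_dvd R I g h"
    and "f \<in> carrier R" "g \<in> carrier R" "h \<in> carrier R"
  shows "local_dvd R I f h"
proof -
  obtain s r where s: "s \<in> carrier R - I" "r \<in> carrier R" "s \<otimes> g = r \<otimes> f"
    using assms by (auto simp: local_dvd_def)
  obtain s' r' where s': "s' \<in> carrier R - I" "r' \<in> carrier R" "s' \<otimes> h = r' \<otimes> g"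
    using assms by (auto simp: local_dvd_def)
  have "(s \<otimes> s') \<otimes> h = s \<otimes> (s' \<otimes> h)" using s s' assms by (simp add: m_assoc)
  also have "\<dots> = r' \<otimes> (s \<otimes> g)" using s s' assms by (simp add: m_lcomm)
  also have "\<dots> = (r' \<otimes> r) \<otimes> f" using s s' assms by (simp add: m_assoc)
  finally show ?thesis
    using compl_mult[OF s(1) s'(1)] s s' by (intro local_dvdI[of "s \<otimes> s'" "r' \<otimes> r"]) auto
qed

lemma (in primeideal) local_dvd_mult:
  assumes "local_dvd R I f g" "local_dvd R I f' g'"
    and "f \<in> carrier R" "g \<in> carrier R" "f' \<in> carrier R" "g' \<in> carrier R"
  shows "local_dvd R I (f \<otimes> f') (g \<otimes> g')"
proof -
  obtain s r where s: "s \<in> carrier R - I" "r \<in> carrier R" "s \<otimes> g = r \<otimes> f"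
    using assms by (auto simp: local_dvd_def)
  obtain s' r' where s': "s' \<in> carrier R - I" "r' \<in> carrier R" "s' \<otimes> g' = r' \<otimes> f'"
    using assms by (auto simp: local_dvd_def)
  have "(s \<otimes> s') \<otimes> (g \<otimes> g') = (s \<otimes> g) \<otimes> (s' \<otimes> g')" using s(1,2) s'(1,2) assms(3-) by (simp add: m_ac)
  also have "\<dots> = (r \<otimes> f) \<otimes> (r' \<otimes> f')" by (simp add: s s')
  also have "\<dots> = (r \<otimes> r') \<otimes> (f \<otimes> f')" using s(1,2) s'(1,2) assms(3-) by (simp add: m_ac)
  finally show ?thesis
    using compl_mult[OF s(1) s'(1)] s s' by (intro local_dvdI[of "s \<otimes> s'" "r \<otimes> r'"]) auto
qed

lemma (in primeideal) dvd_imp_local_dvd: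
  assumes "r \<in> carrier R" "f \<in> carrier R"
  shows "local_dvd R I f (r \<otimes> f)"
  using assms one_notin by (intro local_dvdI[of \<one> r]) auto

lemma (in primeideal) local_dvd_refl: "f \<in> carrier R \<Longrightarrow> local_dvd R I f f"
  using dvd_imp_local_dvd[of \<one> f] by simp

lemma (in primeideal) local_dvd_one_iff:
  assumes "f \<in> carrier R"
  shows "local_dvd R I f \<one> \<longleftrightarrow> f \<notin> I"
proof
  assume "local_dvd R I f \<one>"
  then obtain s r where "s \<in> carrier R - I" "r \<in> carrier R" "s \<otimes> \<one> = r \<otimes> f"
    by (auto simp: local_dvd_def)
  then show "f \<notin> I" using I_l_closed[of f r] by auto
qed (use assms in \<open>auto intro: local_dvdI[of f \<one>]\<close>)

text \<open>This set is the contraction of f R_P to R. It makes the noetherian condition of R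
  available for ideals of R_P, and reduces local divisibility on a product of ideals to products of
  two elements.\<close>

lemma (in primeideal) ideal_local_multiples:
  assumes f: "f \<in> carrier R"
  shows "ideal {g \<in> carrier R. local_dvd R I f g} R" (is "ideal ?M R")
proof (rule idealI)
  have mult: "local_dvd R I f (r \<otimes> g)" if "g \<in> carrier R" "r \<in> carrier R" "local_dvd R I f g" for g r
    using local_dvd_trans[OF that(3) dvd_imp_local_dvd[OF that(2,1)]] that f by auto
  then show "r \<otimes> g \<in> ?M" "g \<otimes> r \<in> ?M" if "g \<in> ?M" "r \<in> carrier R" for r g
    using that by (auto simp: m_comm)
  show "subgroup ?M (add_monoid R)"
  proof (rule add.subgroupI)
    show "?M \<noteq> {}" using local_dvd_refl f by blast
    show "\<ominus> g \<in> ?M" if "g \<in> ?M" for g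
      using mult[of g "\<ominus> \<one>"] that by (simp add: l_minus)
    fix g g' assume g: "g \<in> ?M" and g': "g' \<in> ?M"
    obtain s r where s: "s \<in> carrier R - I" "r \<in> carrier R" "s \<otimes> g = r \<otimes> f"
      using g by (auto simp: local_dvd_def)
    obtain s' r' where s': "s' \<in> carrier R - I" "r' \<in> carrier R" "s' \<otimes> g' = r' \<otimes> f"
      using g' by (auto simp: local_dvd_def)
    have "(s \<otimes> s') \<otimes> (g \<oplus> g') = s' \<otimes> (s \<otimes> g) \<oplus> s \<otimes> (s' \<otimes> g')"
      using s(1,2) s'(1,2) g g' by (simp add: r_distr m_ac)
    also have "\<dots> = (s' \<otimes> r \<oplus> s \<otimes> r') \<otimes> f"
      unfolding s(3) s'(3) using s(1,2) s'(1,2) f by (simp add: l_distr m_assoc)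
    finally have "local_dvd R I f (g \<oplus> g')"
      using compl_mult[OF s(1) s'(1)] s s'
      by (intro local_dvdI[of "s \<otimes> s'" "s' \<otimes> r \<oplus> s \<otimes> r'"]) auto
    then show "g \<oplus> g' \<in> ?M" using g g' by simp
  qed auto
qed (rule ring_axioms)

lemma (in domain) local_dvd_cancel:
  assumes "local_dvd R P (c \<otimes> f) (c \<otimes> g)" "c \<in> carrier R" "c \<noteq> \<zero>" "f \<in> carrier R" "g \<in> carrier R"
  shows "local_dvd R P f g"
proof -
  obtain s r where s: "s \<in> carrier R - P" "r \<in> carrier R" "s \<otimes> (c \<otimes> g) = r \<otimes> (c \<otimes> f)"
    using assms by (auto simp: local_dvd_def)
  then have "c \<otimes> (s \<otimes> g) = c \<otimes> (r \<otimes> f)" using assms(2-) by (simp add: m_lcomm)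
  then have "s \<otimes> g = r \<otimes> f" using s assms(2-) m_lcancel by auto
  with s show ?thesis by (auto simp: local_dvd_def)
qed

section \<open>Orders with respect to a uniformizer\<close>

context noetherian_domain
begin

lemma nat_pow_nonzero:
  assumes "t \<in> carrier R" "t \<noteq> \<zero>"
  shows "t [^] (n::nat) \<noteq> \<zero>"
  by (induction n) (use assms in \<open>simp_all add: integral_iff\<close>)

lemma local_dvd_uniformizer_power_iff:
  assumes "primeideal P R" "uniformizer R P t"
  shows "local_dvd R P (t [^] m) (t [^] n) \<longleftrightarrow> m \<le> (n::nat)"
proof -
  interpret P: primeideal P R by fact
  have tP: "t \<in> P" and t0: "t \<noteq> \<zero>" using assms(2) by (auto simp: uniformizer_def)
  have t: "t \<in> carrier R" using tP by (rule P.Icarr)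
  show ?thesis
  proof
    assume dvd: "local_dvd R P (t [^] m) (t [^] n)"
    show "m \<le> n"
    proof (rule ccontr)
      assume "\<not> m \<le> n"
      then obtain k where m: "m = n + Suc k" by (metis add_Suc_right less_imp_Suc_add not_le)
      have "t [^] m = t [^] n \<otimes> t [^] Suc k" using t by (simp only: m nat_pow_mult)
      with dvd have "local_dvd R P (t [^] n \<otimes> t [^] Suc k) (t [^] n \<otimes> \<one>)" using t by simp
      then have "local_dvd R P (t [^] Suc k) \<one>"
        by (rule local_dvd_cancel) (use t t0 in \<open>auto simp: nat_pow_nonzero\<close>)
      moreover have "t [^] Suc k \<in> P" using tP t by (simp add: P.I_l_closed)
      ultimately show False using P.local_dvd_one_iff t nat_pow_closed by blast
    qed
  next
    assume "m \<le> n"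
    then have "t [^] n = t [^] (n - m) \<otimes> t [^] m" using t by (simp add: nat_pow_mult)
    then show "local_dvd R P (t [^] m) (t [^] n)" using P.dvd_imp_local_dvd t by simp
  qed
qed

text \<open>Among the nonzero elements without an order choose g whose set of local multiples is
  maximal. It lies in P, since otherwise it would be a local unit of order 0; so g equals rt up to a
  local unit. An order n of r would give order n + 1 of g, so r has no order either, and maximality
  makes g divide r locally. Cancelling r in "rt divides r" turns t into a local unit, contradicting
  t in P.\<close>

lemma exists_local_order:
  assumes P: "primeideal P R" and unif: "uniformizer R P t"
    and f: "f \<in> carrier R" "f \<noteq> \<zero>"
  shows "\<exists>n::nat. local_dvd R P (t [^] n) f \<and> local_dvd R P f (t [^] n)"
proof (rule ccontr)
  interpret P: primeideal P R by fact
  have tP: "t \<in> P" and t0: "t \<noteq> \<zero>" using unif by (auto simp: uniformizer_def)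
  have t: "t \<in> carrier R" using tP by (rule P.Icarr)
  define bad where "bad g \<longleftrightarrow> g \<in> carrier R \<and> g \<noteq> \<zero> \<and>
    \<not> (\<exists>n::nat. local_dvd R P (t [^] n) g \<and> local_dvd R P g (t [^] n))" for g
  define mult where "mult g = {h \<in> carrier R. local_dvd R P g h}" for g
  assume "\<not> ?thesis"
  with f have "bad f" by (simp add: bad_def)
  then have ne: "mult ` {g. bad g} \<noteq> {}" by blast
  have id: "ideal M R" if "M \<in> mult ` {g. bad g}" for M
    using that P.ideal_local_multiples by (auto simp: mult_def bad_def)
  obtain g where "bad g" and max: "\<And>h. bad h \<Longrightarrow> mult g \<subseteq> mult h \<Longrightarrow> mult h = mult g"
    using exists_maximal_ideal_of_set[OF ne id] by auto
  then have g: "g \<in> carrier R" "g \<noteq> \<zero>"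
    and no: "\<And>n::nat. local_dvd R P (t [^] n) g \<Longrightarrow> local_dvd R P g (t [^] n) \<Longrightarrow> False"
    by (auto simp: bad_def)
  have "g \<in> P"
  proof (rule ccontr)
    assume "g \<notin> P"
    then have "local_dvd R P g \<one>" using P.local_dvd_one_iff g by blast
    moreover have "local_dvd R P \<one> g" using P.dvd_imp_local_dvd[of g \<one>] g by simp
    ultimately show False using no[of 0] by simp
  qed
  then obtain u r where u: "u \<in> carrier R" "u \<notin> P" and r: "r \<in> carrier R" and ur: "u \<otimes> g = r \<otimes> t"
    using uniformizer_local_dvd[OF unif] by (force simp: local_dvd_def)
  have rt_g: "local_dvd R P (r \<otimes> t) g"
    by (rule P.local_dvdI[of u \<one>]) (use u ur r t in auto)
  have g_rt: "local_dvd R P g (r \<otimes> t)"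
    using P.dvd_imp_local_dvd[of u g] u g ur by simp
  have "r \<noteq> \<zero>"
  proof
    assume "r = \<zero>"
    with ur u g t have "u = \<zero>" using integral_iff by auto
    with u P.zero_closed show False by simp
  qed
  have "bad r"
    unfolding bad_def
  proof (intro conjI notI)
    assume "\<exists>n::nat. local_dvd R P (t [^] n) r \<and> local_dvd R P r (t [^] n)"
    then obtain n :: nat where n: "local_dvd R P (t [^] n) r" "local_dvd R P r (t [^] n)" by blast
    have "local_dvd R P (t [^] Suc n) (r \<otimes> t)" "local_dvd R P (r \<otimes> t) (t [^] Suc n)"
      using P.local_dvd_mult[OF n(1) P.local_dvd_refl[OF t]]
        P.local_dvd_mult[OF n(2) P.local_dvd_refl[OF t]] r t by auto
    then have "local_dvd R P (t [^] Suc n) g" "local_dvd R P g (t [^] Suc n)"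
      using P.local_dvd_trans[OF _ rt_g] P.local_dvd_trans[OF g_rt] r t g by auto
    with no show False by blast
  qed (use r \<open>r \<noteq> \<zero>\<close> in auto)
  moreover have "local_dvd R P r g"
    using P.local_dvd_trans[OF _ rt_g] P.dvd_imp_local_dvd[of t r] r t g by (simp add: m_comm)
  then have "mult g \<subseteq> mult r"
    using P.local_dvd_trans r g by (auto simp: mult_def)
  ultimately have "mult r = mult g" using max by blast
  moreover have "r \<in> mult r" using r P.local_dvd_refl by (simp add: mult_def)
  ultimately have "local_dvd R P g r" by (auto simp: mult_def)
  then have "local_dvd R P (r \<otimes> t) (r \<otimes> \<one>)" using P.local_dvd_trans[OF rt_g] r t g by simp
  then have "local_dvd R P t \<one>"
    by (rule local_dvd_cancel) (use r t \<open>r \<noteq> \<zero>\<close> in auto)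
  with tP t show False using P.local_dvd_one_iff by blast
qed

text \<open>A nonzero prime Q inside P contains some g that is locally a power of t, up to a unit.
  As elements outside P are outside Q, this puts a power of t, hence t, into Q, and then up = rt
  puts every p of P into Q.\<close>

lemma uniformizer_imp_height_one:
  assumes P: "primeideal P R" and unif: "uniformizer R P t"
  shows "P \<in> height_one_primes R"
  unfolding height_one_primes_iff
proof (intro conjI allI impI P)
  interpret P: primeideal P R by fact
  have tP: "t \<in> P" and t0: "t \<noteq> \<zero>" using unif by (auto simp: uniformizer_def)
  have t: "t \<in> carrier R" using tP by (rule P.Icarr)
  show "P \<noteq> {\<zero>}" using tP t0 by auto
  fix Q assume Q: "primeideal Q R" "Q \<subseteq> P" "Q \<noteq> {\<zero>}"
  interpret Q: primeideal Q R by fact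
  obtain g where g: "g \<in> Q" "g \<noteq> \<zero>" using Q(3) Q.zero_closed by blast
  obtain n :: nat where n: "local_dvd R P g (t [^] n)"
    using exists_local_order[OF P unif Q.Icarr[OF g(1)] g(2)] by blast
  then obtain s r where s: "s \<in> carrier R" "s \<notin> P" "r \<in> carrier R" "s \<otimes> t [^] n = r \<otimes> g"
    by (auto simp: local_dvd_def)
  have "s \<otimes> t [^] n \<in> Q" using s g Q.I_l_closed by simp
  then have "t [^] n \<in> Q" using Q.I_prime[of s "t [^] n"] s t Q(2) by auto
  then have tQ: "t \<in> Q"
  proof (induction n)
    case 0
    with Q.one_notin show ?case by simp
  next
    case (Suc n)
    then show ?case using Q.I_prime[of "t [^] n" t] t by auto
  qed
  have "p \<in> Q" if p: "p \<in> P" for p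
  proof -
    obtain u r where u: "u \<in> carrier R" "u \<notin> P" "r \<in> carrier R" "u \<otimes> p = r \<otimes> t"
      using uniformizer_local_dvd[OF unif p] by (auto simp: local_dvd_def)
    then have "u \<otimes> p \<in> Q" using tQ Q.I_l_closed by simp
    then show ?thesis using Q.I_prime[of u p] u p P.Icarr Q(2) by auto
  qed
  with Q(2) show "Q = P" by blast
qed

end

section \<open>The valuations of the height one primes\<close>

lemma (in ring) ideal_prod_subset:
  assumes "ideal K R" "\<And>i j. i \<in> I \<Longrightarrow> j \<in> J \<Longrightarrow> i \<otimes> j \<in> K"
  shows "I \<cdot> J \<subseteq> K"
proof
  interpret K: ideal K R by fact
  fix z assume "z \<in> I \<cdot> J"
  then show "z \<in> K"
    by (induct z rule: ideal_prod.induct) (auto simp: assms(2))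
qed

section \<open>Powers of ideals\<close>

context cring
begin

lemma ideal_ideal_power:
  assumes "ideal I R"
  shows "ideal (ideal_power R I n) R"
proof -
  interpret S: comm_monoid "ideals_set R" by (rule ideals_set_is_comm_monoid)
  have "I \<in> carrier (ideals_set R)" using assms by (simp add: ideals_set_def)
  then have "ideal_power R I n \<in> carrier (ideals_set R)" by (rule S.nat_pow_closed)
  then show ?thesis by (simp add: ideals_set_def)
qed

lemma ideal_power_0: "ideal_power R I 0 = carrier R"
  by (simp add: ideals_set_def nat_pow_def)

lemma ideal_power_Suc: "ideal_power R I (Suc n) = ideal_power R I n \<cdot> I"
  by (simp add: ideals_set_def nat_pow_def)

lemma nat_pow_mem_ideal_power:
  assumes "x \<in> I" "x \<in> carrier R"
  shows "x [^] n \<in> ideal_power R I n"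
proof (induction n)
  case 0
  show ?case unfolding ideal_power_0 by simp
next
  case (Suc n)
  show ?case
    unfolding ideal_power_Suc nat_pow_Suc by (rule ideal_prod.prod) (use Suc assms in auto)
qed

lemma ideal_power_Suc_subset:
  assumes "ideal I R"
  shows "ideal_power R I (Suc n) \<subseteq> I"
  unfolding ideal_power_Suc using ideal_prod_inter[OF ideal_ideal_power[OF assms] assms] by blast

lemma ideal_power_local_dvd:
  assumes P: "primeideal P R" and I: "ideal I R" and c: "c \<in> carrier R"
    and dvd: "\<And>x. x \<in> I \<Longrightarrow> local_dvd R P c x"
    and "z \<in> ideal_power R I n"
  shows "local_dvd R P (c [^] n) z"
  using assms(5)
proof (induction n arbitrary: z)
  case 0
  interpret P: primeideal P R by fact
  have "z \<in> carrier R" using 0 unfolding ideal_power_0 .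
  then show ?case using P.dvd_imp_local_dvd[of z \<one>] by simp
next
  case (Suc n)
  interpret P: primeideal P R by fact
  interpret I: ideal I R by fact
  interpret In: ideal "ideal_power R I n" R by (rule ideal_ideal_power[OF I])
  have "z \<in> ideal_power R I n \<cdot> I" using Suc.prems unfolding ideal_power_Suc .
  also have "\<dots> \<subseteq> {g \<in> carrier R. local_dvd R P (c [^] Suc n) g}"
  proof (rule ideal_prod_subset[OF P.ideal_local_multiples[OF nat_pow_closed[OF c]]])
    fix i j assume ij: "i \<in> ideal_power R I n" "j \<in> I"
    then have carr: "i \<in> carrier R" "j \<in> carrier R" using In.Icarr I.Icarr by auto
    have "local_dvd R P (c [^] n \<otimes> c) (i \<otimes> j)"
      by (rule P.local_dvd_mult[OF Suc.IH[OF ij(1)] dvd[OF ij(2)] nat_pow_closed[OF c] carr(1) c carr(2)])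
    then show "i \<otimes> j \<in> {g \<in> carrier R. local_dvd R P (c [^] Suc n) g}" using carr by simp
  qed
  finally show ?case by simp
qed

end

text \<open>The valuation v_P, defined through the symbolic powers so that no choice of a
  uniformizer enters. At zero no such n exists and the value is unspecified, so zero is treated
  separately wherever orders are used.\<close>

definition ord_at :: "('a, 'b) ring_scheme \<Rightarrow> 'a set \<Rightarrow> 'a \<Rightarrow> nat" where
  "ord_at R P f = (THE n. \<forall>m. f \<in> symbolic_power R P m \<longleftrightarrow> m \<le> n)"

text \<open>P^n generates t^n R_P in the localisation, and the symbolic power is its contraction to
  R.\<close>

lemma (in domain) symbolic_power_prime:
  assumes P: "primeideal P R" and unif: "uniformizer R P t"
  shows "symbolic_power R P n = {g \<in> carrier R. local_dvd R P (t [^] n) g}"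
proof -
  interpret P: primeideal P R by fact
  have tP: "t \<in> P" using unif by (simp add: uniformizer_def)
  have t: "t \<in> carrier R" using tP by (rule P.Icarr)
  show ?thesis
  proof (cases "n = 0")
    case True
    have "local_dvd R P \<one> g" if "g \<in> carrier R" for g
      using P.dvd_imp_local_dvd[of g \<one>] that by simp
    then show ?thesis by (auto simp: True symbolic_power_def)
  next
    case False
    have "(\<exists>s\<in>carrier R - P. s \<otimes> g \<in> ideal_power R P n) \<longleftrightarrow> local_dvd R P (t [^] n) g" (is "?l \<longleftrightarrow> ?r")
      if g: "g \<in> carrier R" for g
    proof
      assume ?l
      then obtain s where s: "s \<in> carrier R" "s \<notin> P" "s \<otimes> g \<in> ideal_power R P n" by blast
      have "local_dvd R P (t [^] n) (s \<otimes> g)"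
        by (rule ideal_power_local_dvd[OF P P.is_ideal t uniformizer_local_dvd[OF unif] s(3)])
      moreover have "local_dvd R P (s \<otimes> g) g"
        by (rule P.local_dvdI[of s \<one>]) (use s g in auto)
      ultimately show ?r by (rule P.local_dvd_trans) (use s g t in auto)
    next
      assume ?r
      then obtain s r where s: "s \<in> carrier R - P" "r \<in> carrier R" "s \<otimes> g = r \<otimes> t [^] n"
        by (auto simp: local_dvd_def)
      have "r \<otimes> t [^] n \<in> ideal_power R P n"
        using nat_pow_mem_ideal_power[OF tP t] s(2)
        by (rule ideal.I_l_closed[OF ideal_ideal_power[OF P.is_ideal]])
      then have "s \<otimes> g \<in> ideal_power R P n" by (simp only: s(3))
      with s(1) show ?l by (rule bexI[rotated])
    qed
    then show ?thesis using False
      by (auto simp: symbolic_power_def assoc_primes_prime[OF P])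
  qed
qed

section \<open>Valuations on a Noetherian normal domain\<close>

locale noetherian_normal_domain = noetherian_domain +
  assumes normal: "normal_domain R"
begin

lemma height_one_primeideal: "P \<in> height_one_primes R \<Longrightarrow> primeideal P R"
  by (simp add: height_one_primes_def)

lemma height_one_subset_eq:
  assumes "P \<in> height_one_primes R" "Q \<in> height_one_primes R" "P \<subseteq> Q"
  shows "P = Q"
  using assms by (metis height_one_primes_iff)

text \<open>For a nonzero f in P take a prime ideal quotient of (f) disjoint from the complement of
  P. It lies inside P and contains f, so by height one it is P itself. This presents P in the form
  to which the integrality argument applies.\<close>

lemma exists_uniformizer:
  assumes P: "P \<in> height_one_primes R"
  shows "\<exists>t. uniformizer R P t"
proof -
  interpret P: primeideal P R by (rule height_one_primeideal[OF P])
  have "P \<noteq> {\<zero>}" using P by (simp add: height_one_primes_iff)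
  then obtain f where f: "f \<in> P" "f \<noteq> \<zero>" using P.zero_closed by blast
  then have fc: "f \<in> carrier R" by (simp add: P.Icarr)
  have I: "ideal (PIdl f) R" by (rule cgenideal_ideal[OF fc])
  have "PIdl f \<subseteq> P" using f by (intro cgenideal_minimal P.is_ideal)
  then have disj: "colon_ideal R (PIdl f) \<one> \<inter> (carrier R - P) = {}"
    by (auto simp: colon_ideal_def)
  have "\<exists>r\<in>carrier R. primeideal (colon_ideal R (PIdl f) (r \<otimes> \<one>)) R \<and>
      colon_ideal R (PIdl f) (r \<otimes> \<one>) \<inter> (carrier R - P) = {}"
    by (rule exists_prime_colon_ideal[OF I one_closed _ _ P.compl_mult disj])
      (use P.one_notin in auto)
  then obtain r where r: "r \<in> carrier R"
    and Q: "primeideal (colon_ideal R (PIdl f) (r \<otimes> \<one>)) R"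
      "colon_ideal R (PIdl f) (r \<otimes> \<one>) \<inter> (carrier R - P) = {}"
    by blast
  have "colon_ideal R (PIdl f) (r \<otimes> \<one>) \<subseteq> P" using Q(2) by (auto simp: colon_ideal_def)
  moreover have "f \<in> colon_ideal R (PIdl f) (r \<otimes> \<one>)"
    using subset_colon_ideal[OF I, of "r \<otimes> \<one>"] cgenideal_self[OF fc] r by auto
  then have "colon_ideal R (PIdl f) (r \<otimes> \<one>) \<noteq> {\<zero>}" using f by blast
  ultimately have "P = colon_ideal R (PIdl f) (r \<otimes> \<one>)"
    using P Q(1) unfolding height_one_primes_iff by metis
  with exists_uniformizer_colon_ideal[OF normal fc f(2) _ P.primeideal] r show ?thesis
    by (metis m_closed one_closed)
qed

lemma ord_at_uniformizer:
  assumes P: "P \<in> height_one_primes R" and t: "uniformizer R P t"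
    and f: "f \<in> carrier R" "f \<noteq> \<zero>"
  shows "local_dvd R P (t [^] ord_at R P f) f" "local_dvd R P f (t [^] ord_at R P f)"
    "f \<in> symbolic_power R P m \<longleftrightarrow> m \<le> ord_at R P f"
proof -
  interpret P: primeideal P R by (rule height_one_primeideal[OF P])
  have tP: "t \<in> P" using t by (simp add: uniformizer_def)
  have tc: "t \<in> carrier R" using tP by (rule P.Icarr)
  obtain n :: nat where n: "local_dvd R P (t [^] n) f" "local_dvd R P f (t [^] n)"
    using exists_local_order[OF P.primeideal t f] by blast
  have iff: "f \<in> symbolic_power R P m \<longleftrightarrow> m \<le> n" for m
  proof -
    have "f \<in> symbolic_power R P m \<longleftrightarrow> local_dvd R P (t [^] m) f"
      using f by (simp add: symbolic_power_prime[OF P.primeideal t])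
    also have "\<dots> \<longleftrightarrow> local_dvd R P (t [^] m) (t [^] n)"
      using P.local_dvd_trans[OF _ n(1)] P.local_dvd_trans[OF _ n(2)] tc f by auto
    finally show ?thesis by (simp add: local_dvd_uniformizer_power_iff[OF P.primeideal t])
  qed
  have "ord_at R P f = n"
    unfolding ord_at_def
  proof (rule the_equality)
    show "n' = n" if "\<forall>m. f \<in> symbolic_power R P m \<longleftrightarrow> m \<le> n'" for n'
      using that iff by (metis order_refl order_antisym)
  qed (use iff in blast)
  with n iff show "local_dvd R P (t [^] ord_at R P f) f" "local_dvd R P f (t [^] ord_at R P f)"
    "f \<in> symbolic_power R P m \<longleftrightarrow> m \<le> ord_at R P f"
    by simp_all
qed

lemma mem_symbolic_power_prime_iff:
  assumes "P \<in> height_one_primes R" "f \<in> carrier R" "f \<noteq> \<zero>"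
  shows "f \<in> symbolic_power R P m \<longleftrightarrow> m \<le> ord_at R P f"
  using exists_uniformizer[OF assms(1)] ord_at_uniformizer(3)[OF assms(1) _ assms(2,3)] by blast

lemma ideal_symbolic_power_prime:
  assumes "P \<in> height_one_primes R"
  shows "ideal (symbolic_power R P m) R"
proof -
  interpret P: primeideal P R by (rule height_one_primeideal[OF assms])
  obtain t where t: "uniformizer R P t" using exists_uniformizer[OF assms] by blast
  then have "t \<in> carrier R" using P.Icarr by (simp add: uniformizer_def)
  then show ?thesis
    unfolding symbolic_power_prime[OF P.primeideal t] by (intro P.ideal_local_multiples) simp
qed

lemma ord_at_eqI:
  assumes P: "P \<in> height_one_primes R" and t: "uniformizer R P t"
    and f: "f \<in> carrier R" "f \<noteq> \<zero>"
    and n: "local_dvd R P (t [^] (n::nat)) f" "local_dvd R P f (t [^] n)"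
  shows "ord_at R P f = n"
proof -
  interpret P: primeideal P R by (rule height_one_primeideal[OF P])
  have tP: "t \<in> P" using t by (simp add: uniformizer_def)
  have tc: "t \<in> carrier R" using tP by (rule P.Icarr)
  have "local_dvd R P (t [^] ord_at R P f) (t [^] n)"
    by (rule P.local_dvd_trans[OF ord_at_uniformizer(1)[OF P t f] n(2)]) (use tc f in auto)
  moreover have "local_dvd R P (t [^] n) (t [^] ord_at R P f)"
    by (rule P.local_dvd_trans[OF n(1) ord_at_uniformizer(2)[OF P t f]]) (use tc f in auto)
  ultimately show ?thesis by (simp add: local_dvd_uniformizer_power_iff[OF P.primeideal t])
qed

lemma ord_at_le_iff:
  assumes P: "P \<in> height_one_primes R"
    and f: "f \<in> carrier R" "f \<noteq> \<zero>" and g: "g \<in> carrier R" "g \<noteq> \<zero>"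
  shows "ord_at R P f \<le> ord_at R P g \<longleftrightarrow> local_dvd R P f g"
proof -
  interpret P: primeideal P R by (rule height_one_primeideal[OF P])
  obtain t where t: "uniformizer R P t" using exists_uniformizer[OF P] by blast
  then have tc: "t [^] n \<in> carrier R" for n :: nat using P.Icarr by (simp add: uniformizer_def)
  note F = ord_at_uniformizer[OF P t f] and G = ord_at_uniformizer[OF P t g]
  have "local_dvd R P f g" if "local_dvd R P (t [^] ord_at R P f) (t [^] ord_at R P g)"
    by (rule P.local_dvd_trans[OF P.local_dvd_trans[OF F(2) that] G(1)]) (use f g tc in auto)
  moreover have "local_dvd R P (t [^] ord_at R P f) (t [^] ord_at R P g)" if "local_dvd R P f g"
    by (rule P.local_dvd_trans[OF P.local_dvd_trans[OF F(1) that] G(2)]) (use f g tc in auto)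
  ultimately show ?thesis by (metis local_dvd_uniformizer_power_iff[OF P.primeideal t])
qed

lemma ord_at_mult:
  assumes P: "P \<in> height_one_primes R"
    and f: "f \<in> carrier R" "f \<noteq> \<zero>" and g: "g \<in> carrier R" "g \<noteq> \<zero>"
  shows "ord_at R P (f \<otimes> g) = ord_at R P f + ord_at R P g"
proof -
  interpret P: primeideal P R by (rule height_one_primeideal[OF P])
  obtain t where t: "uniformizer R P t" using exists_uniformizer[OF P] by blast
  then have tc: "t \<in> carrier R" using P.Icarr by (simp add: uniformizer_def)
  note F = ord_at_uniformizer[OF P t f] and G = ord_at_uniformizer[OF P t g]
  show ?thesis
  proof (rule ord_at_eqI[OF P t])
    have eq: "t [^] (ord_at R P f + ord_at R P g) = t [^] ord_at R P f \<otimes> t [^] ord_at R P g"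
      using tc by (simp add: nat_pow_mult)
    show "local_dvd R P (t [^] (ord_at R P f + ord_at R P g)) (f \<otimes> g)"
      unfolding eq by (rule P.local_dvd_mult[OF F(1) G(1)]) (use f g tc in auto)
    show "local_dvd R P (f \<otimes> g) (t [^] (ord_at R P f + ord_at R P g))"
      unfolding eq by (rule P.local_dvd_mult[OF F(2) G(2)]) (use f g tc in auto)
  qed (use f g integral_iff in auto)
qed

lemma ord_at_eq_0_iff:
  assumes P: "P \<in> height_one_primes R" and f: "f \<in> carrier R" "f \<noteq> \<zero>"
  shows "ord_at R P f = 0 \<longleftrightarrow> f \<notin> P"
proof -
  interpret P: primeideal P R by (rule height_one_primeideal[OF P])
  have "ord_at R P (\<one> \<otimes> \<one>) = ord_at R P \<one> + ord_at R P \<one>" by (rule ord_at_mult[OF P]) auto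
  then have "ord_at R P \<one> = 0" by simp
  then show ?thesis
    using ord_at_le_iff[OF P f, of \<one>] P.local_dvd_one_iff[OF f(1)] by simp
qed

lemma ord_at_one: "P \<in> height_one_primes R \<Longrightarrow> ord_at R P \<one> = 0"
  using ord_at_eq_0_iff[of P \<one>] primeideal.one_notin[OF height_one_primeideal] by simp

lemma ord_at_pow:
  assumes P: "P \<in> height_one_primes R" and f: "f \<in> carrier R" "f \<noteq> \<zero>"
  shows "ord_at R P (f [^] (n::nat)) = n * ord_at R P f"
  by (induction n) (use f in \<open>simp_all add: ord_at_one[OF P] ord_at_mult[OF P] nat_pow_nonzero\<close>)

lemma exists_ord_at_eq_1:
  assumes P: "P \<in> height_one_primes R"
  shows "\<exists>t\<in>carrier R. t \<noteq> \<zero> \<and> ord_at R P t = 1"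
proof -
  interpret P: primeideal P R by (rule height_one_primeideal[OF P])
  obtain t where t: "uniformizer R P t" using exists_uniformizer[OF P] by blast
  then have "t \<in> carrier R" "t \<noteq> \<zero>" using P.Icarr by (simp_all add: uniformizer_def)
  then show ?thesis
    using ord_at_eqI[OF P t, of t 1] P.local_dvd_refl[of t] by auto
qed

text \<open>This is $R = \bigcap_P R_P$ over the height one primes: the associated primes of a nonzero
  principal ideal have height one.\<close>

lemma mem_cgenideal_iff_ord_at:
  assumes f: "f \<in> carrier R" "f \<noteq> \<zero>" and g: "g \<in> carrier R" "g \<noteq> \<zero>"
  shows "g \<in> PIdl f \<longleftrightarrow> (\<forall>P\<in>height_one_primes R. ord_at R P f \<le> ord_at R P g)"
proof (intro iffI ballI)
  fix P assume "g \<in> PIdl f" and P: "P \<in> height_one_primes R"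
  then obtain r where "r \<in> carrier R" "g = r \<otimes> f" by (auto simp: cgenideal_def)
  then have "local_dvd R P f g"
    using primeideal.dvd_imp_local_dvd[OF height_one_primeideal[OF P]] f by blast
  then show "ord_at R P f \<le> ord_at R P g" using ord_at_le_iff[OF P f g] by blast
next
  assume le: "\<forall>P\<in>height_one_primes R. ord_at R P f \<le> ord_at R P g"
  show "g \<in> PIdl f"
  proof (rule ccontr)
    assume "g \<notin> PIdl f"
    have I: "ideal (PIdl f) R" by (rule cgenideal_ideal[OF f(1)])
    obtain P r where r: "r \<in> carrier R" and Pass: "P \<in> assoc_primes R (PIdl f)"
      and Pr: "P = colon_ideal R (PIdl f) (r \<otimes> g)"
      by (rule exists_assoc_prime[OF I g(1) \<open>g \<notin> PIdl f\<close>])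
    have "primeideal P R" using Pass by (simp add: assoc_primes_iff[OF I])
    then interpret P: primeideal P R .
    obtain t where "uniformizer R P t"
      using exists_uniformizer_colon_ideal[OF normal f _ P.primeideal Pr] r g by blast
    \<comment> \<open>So the hypothesis on orders applies to this P. Local divisibility there
      provides s outside P with s(rg) in (f), although P consists of all such s.\<close>
    then have P: "P \<in> height_one_primes R" by (rule uniformizer_imp_height_one[OF P.primeideal])
    have "local_dvd R P f g" using le P ord_at_le_iff[OF P f g] by blast
    then have "local_dvd R P f (r \<otimes> g)"
      using P.local_dvd_trans[OF _ P.dvd_imp_local_dvd[OF r g(1)]] f g r by auto
    then obtain s r' where s: "s \<in> carrier R" "s \<notin> P" "r' \<in> carrier R" "s \<otimes> (r \<otimes> g) = r' \<otimes> f"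
      by (auto simp: local_dvd_def)
    then have "s \<otimes> (r \<otimes> g) \<in> PIdl f" unfolding cgenideal_def by blast
    then have "s \<in> P" unfolding Pr colon_ideal_def using s(1) by blast
    with s(2) show False by blast
  qed
qed

end

section \<open>Symbolic powers in terms of valuations\<close>

lemma (in cring) cgenideal_prod:
  assumes "a \<in> carrier R" "b \<in> carrier R"
  shows "(PIdl a) \<cdot> (PIdl b) = PIdl (a \<otimes> b)"
proof
  have carr: "a \<otimes> b \<in> carrier R" using assms by simp
  show "(PIdl a) \<cdot> (PIdl b) \<subseteq> PIdl (a \<otimes> b)"
  proof (rule ideal_prod_subset[OF cgenideal_ideal[OF carr]])
    fix i j assume "i \<in> PIdl a" "j \<in> PIdl b"
    then obtain r s where "r \<in> carrier R" "i = r \<otimes> a" "s \<in> carrier R" "j = s \<otimes> b"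
      unfolding cgenideal_def by blast
    moreover from this have "i \<otimes> j = (r \<otimes> s) \<otimes> (a \<otimes> b)" using assms by (simp add: m_ac)
    ultimately show "i \<otimes> j \<in> PIdl (a \<otimes> b)" unfolding cgenideal_def by blast
  qed
  have "a \<otimes> b \<in> (PIdl a) \<cdot> (PIdl b)"
    by (intro ideal_prod.prod cgenideal_self assms)
  then show "PIdl (a \<otimes> b) \<subseteq> (PIdl a) \<cdot> (PIdl b)"
    by (intro cgenideal_minimal ideal_prod_is_ideal cgenideal_ideal assms)
qed

lemma (in cring) ideal_power_cgenideal:
  assumes "a \<in> carrier R"
  shows "ideal_power R (PIdl a) n = PIdl (a [^] n)"
proof (induction n)
  case 0
  have "PIdl \<one> = carrier R" unfolding cgenideal_def by force
  then show ?case unfolding ideal_power_0 by simp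
next
  case (Suc n)
  then show ?case unfolding ideal_power_Suc using assms by (simp add: cgenideal_prod)
qed

lemma (in cring) exists_mem_Inter_not_mem:
  assumes J: "ideal J R" and P: "primeideal P R" and "finite F"
    and "\<And>Q. Q \<in> F \<Longrightarrow> ideal Q R" and "\<not> J \<subseteq> P" and "\<And>Q. Q \<in> F \<Longrightarrow> \<not> Q \<subseteq> P"
  shows "\<exists>z\<in>J. z \<notin> P \<and> (\<forall>Q\<in>F. z \<in> Q)"
  using assms(3,4,6)
proof (induction F)
  case empty
  then show ?case using assms(5) by blast
next
  case (insert Q F)
  interpret J: ideal J R by fact
  interpret P: primeideal P R by fact
  have "\<exists>z\<in>J. z \<notin> P \<and> (\<forall>Q\<in>F. z \<in> Q)"
    by (rule insert.IH) (use insert.prems in simp_all)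
  then obtain z where z: "z \<in> J" "z \<notin> P" "\<forall>Q\<in>F. z \<in> Q" by (elim bexE conjE)
  have Q: "ideal Q R" by (simp add: insert.prems(1))
  obtain y where y: "y \<in> Q" "y \<notin> P" using insert.prems(2)[of Q] by auto
  have yc: "y \<in> carrier R" and zc: "z \<in> carrier R"
    using y(1) z(1) ideal.Icarr[OF Q] J.Icarr by auto
  have "y \<otimes> z \<in> Q'" if "Q' \<in> insert Q F" for Q'
  proof (cases "Q' = Q")
    case True
    then show ?thesis using ideal.I_r_closed[OF Q y(1) zc] by simp
  next
    case False
    then have "Q' \<in> F" using that by simp
    with z(3) yc insert.prems(1)[OF that] show ?thesis by (simp add: ideal.I_l_closed)
  qed
  moreover have "y \<otimes> z \<in> J" using z(1) yc by (rule J.I_l_closed)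
  moreover have "y \<otimes> z \<notin> P" using P.I_prime[OF yc zc] y(2) z(2) by blast
  ultimately show ?case by (intro bexI[of _ "y \<otimes> z"]) simp_all
qed

text \<open>If x in J avoids \<open>F\<close> but lies in the new prime P, incomparability yields z
  in J that lies in every member of \<open>F\<close> but not in P; then x + z avoids them all.
  Distinct height one primes are incomparable, so this form suffices.\<close>

lemma (in cring) prime_avoidance:
  assumes J: "ideal J R" and "finite F" and "\<And>P. P \<in> F \<Longrightarrow> primeideal P R"
    and "\<And>P Q. P \<in> F \<Longrightarrow> Q \<in> F \<Longrightarrow> P \<subseteq> Q \<Longrightarrow> P = Q"
    and "\<And>P. P \<in> F \<Longrightarrow> \<not> J \<subseteq> P"
  shows "\<exists>x\<in>J. \<forall>P\<in>F. x \<notin> P"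
  using assms(2-)
proof (induction F)
  case empty
  have "\<zero> \<in> J" using J by (simp add: additive_subgroup.zero_closed ideal.axioms(1))
  then show ?case by (intro bexI[of _ \<zero>]) simp_all
next
  case (insert P F)
  interpret J: ideal J R by fact
  have primeP: "primeideal P R" by (simp add: insert.prems(1))
  then interpret P: primeideal P R .
  have "\<exists>x\<in>J. \<forall>P\<in>F. x \<notin> P"
    by (rule insert.IH) (use insert.prems in simp_all)
  then obtain x where x: "x \<in> J" "\<forall>Q\<in>F. x \<notin> Q" by (elim bexE)
  show ?case
  proof (cases "x \<in> P")
    case True
    have Fid: "ideal Q R" if "Q \<in> F" for Q
      using that insert.prems(1)[of Q] by (simp add: primeideal.axioms(1))
    have "\<not> Q \<subseteq> P" if "Q \<in> F" for Q
      using that insert.prems(2)[of Q P] insert.hyps(2) by auto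
    then have "\<exists>z\<in>J. z \<notin> P \<and> (\<forall>Q\<in>F. z \<in> Q)"
      using insert.prems(3)[of P] Fid by (intro exists_mem_Inter_not_mem[OF J primeP insert.hyps(1)]) simp_all
    then obtain z where z: "z \<in> J" "z \<notin> P" "\<forall>Q\<in>F. z \<in> Q" by (elim bexE conjE)
    have zc: "z \<in> carrier R" and xc: "x \<in> carrier R" using x(1) z(1) J.Icarr by auto
    have cancel: "a \<in> I" if "ideal I R" "a \<oplus> b \<in> I" "b \<in> I" "a \<in> carrier R" for a b I
    proof -
      interpret I: ideal I R by fact
      have bc: "b \<in> carrier R" using that(3) by (rule I.Icarr)
      have "(a \<oplus> b) \<oplus> \<ominus> b \<in> I" by (rule I.a_closed[OF that(2) I.a_inv_closed[OF that(3)]])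
      moreover have "(a \<oplus> b) \<oplus> \<ominus> b = a" using that(4) bc by (simp add: a_assoc r_neg)
      ultimately show ?thesis by simp
    qed
    have "z \<oplus> x \<notin> P" using cancel[OF P.is_ideal _ True zc] z(2) by blast
    moreover have "x \<oplus> z \<notin> Q" if "Q \<in> F" for Q
      using cancel[OF Fid[OF that], of x z] that z(3) x(2) xc by blast
    moreover have "x \<oplus> z \<in> J" using x(1) z(1) by (rule J.a_closed)
    ultimately show ?thesis using a_comm[OF xc zc] by (intro bexI[of _ "x \<oplus> z"]) auto
  next
    case False
    with x show ?thesis by (intro bexI[of _ x]) simp_all
  qed
qed

text \<open>If sf lies in I while f does not, then s lies in (I : f), which is contained in an
  associated prime; but s avoids all of these.\<close>

lemma (in noetherian_domain) symbolic_power_subset: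
  assumes I: "ideal I R" and "0 < a"
  shows "symbolic_power R I a \<subseteq> I"
proof
  fix f assume "f \<in> symbolic_power R I a"
  then obtain s where f: "f \<in> carrier R" and s: "s \<in> carrier R" "\<forall>P\<in>assoc_primes R I. s \<notin> P"
    and "s \<otimes> f \<in> ideal_power R I a"
    using assms(2) by (auto simp: symbolic_power_def)
  moreover obtain b where "a = Suc b" using assms(2) by (cases a) auto
  ultimately have "s \<otimes> f \<in> I" using ideal_power_Suc_subset[OF I, of b] by blast
  with s(1) have sc: "s \<in> colon_ideal R I f" by (simp add: colon_ideal_def)
  show "f \<in> I"
  proof (rule ccontr)
    assume "f \<notin> I"
    obtain P r where "P \<in> assoc_primes R I" "colon_ideal R I f \<subseteq> P"
      by (rule exists_assoc_prime[OF I f \<open>f \<notin> I\<close>])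
    with sc s(2) show False by blast
  qed
qed

text \<open>The exponent e_P: for nonzero I and P of height one, I R_P is the e_P-th power of the
  maximal ideal. Zero is left out because \<open>ord_at\<close> is unspecified there.\<close>

definition ord_ideal :: "('a, 'b) ring_scheme \<Rightarrow> 'a set \<Rightarrow> 'a set \<Rightarrow> nat" where
  "ord_ideal R P I = (LEAST n. \<exists>g\<in>I. g \<noteq> \<zero>\<^bsub>R\<^esub> \<and> ord_at R P g = n)"

section \<open>Ideals of pure height one\<close>

context noetherian_normal_domain
begin

lemma ord_ideal_attained:
  assumes "ideal I R" "I \<noteq> {\<zero>}"
  shows "\<exists>g\<in>I. g \<noteq> \<zero> \<and> ord_at R P g = ord_ideal R P I"
proof -
  have "\<zero> \<in> I" using assms(1) by (simp add: additive_subgroup.zero_closed ideal.axioms(1))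
  with assms(2) obtain g where "g \<in> I" "g \<noteq> \<zero>" by blast
  then have "\<exists>n. \<exists>g\<in>I. g \<noteq> \<zero> \<and> ord_at R P g = n" by blast
  then show ?thesis unfolding ord_ideal_def by (rule LeastI_ex)
qed

lemma ord_ideal_le:
  assumes "g \<in> I" "g \<noteq> \<zero>"
  shows "ord_ideal R P I \<le> ord_at R P g"
  unfolding ord_ideal_def by (rule Least_le) (use assms in blast)

lemma pure_height_one_assoc:
  assumes "pure_height R I 1"
  shows "assoc_primes R I \<subseteq> height_one_primes R"
  using assms by (auto simp: pure_height_def height_one_primes_def assoc_primes_iff)

text \<open>An associated prime (I : x) has height one, so it contains some p \<noteq> 0, and px is
  a nonzero element of I.\<close>

lemma pure_height_one_nonzero:
  assumes q: "pure_height R I 1"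
  shows "I \<noteq> {\<zero>}"
proof -
  have I: "ideal I R" and proper: "I \<noteq> carrier R" using q by (auto simp: pure_height_def)
  interpret I: ideal I R by fact
  have "\<one> \<notin> I" using proper I.one_imp_carrier by blast
  then obtain P where P: "P \<in> assoc_primes R I" using exists_assoc_prime[OF I one_closed] by metis
  then obtain x where x: "x \<in> carrier R" "P = colon_ideal R I x" using assoc_primes_iff[OF I] by blast
  have "P \<in> height_one_primes R" using P pure_height_one_assoc[OF q] by blast
  then have "primeideal P R" "P \<noteq> {\<zero>}" by (simp_all add: height_one_primes_iff)
  then interpret P: primeideal P R by simp
  obtain p where p: "p \<in> P" "p \<noteq> \<zero>" using P.zero_closed \<open>P \<noteq> {\<zero>}\<close> by blast
  have memP: "a \<in> P \<longleftrightarrow> a \<in> carrier R \<and> a \<otimes> x \<in> I" for a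
    unfolding x(2) colon_ideal_def by blast
  have pc: "p \<in> carrier R" and px: "p \<otimes> x \<in> I" using p(1) memP by blast+
  have "x \<noteq> \<zero>"
  proof
    assume "x = \<zero>"
    then have "\<one> \<in> P" using I.zero_closed memP[of \<one>] by simp
    with P.one_notin show False by simp
  qed
  then have "p \<otimes> x \<noteq> \<zero>" using p pc x integral_iff by simp
  with px show ?thesis by blast
qed

text \<open>Associated primes contain I. Here they have height one, and only finitely many such
  primes contain a fixed nonzero f in I.\<close>

lemma finite_assoc_primes:
  assumes q: "pure_height R I 1"
  shows "finite (assoc_primes R I)"
proof -
  have I: "ideal I R" using q by (simp add: pure_height_def)
  interpret I: ideal I R by fact
  obtain f where f: "f \<in> I" "f \<noteq> \<zero>" using pure_height_one_nonzero[OF q] I.zero_closed by blast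
  have "assoc_primes R I \<subseteq> {P \<in> height_one_primes R. f \<in> P}"
  proof
    fix P assume P: "P \<in> assoc_primes R I"
    then obtain x where "x \<in> carrier R" "P = colon_ideal R I x"
      using assoc_primes_iff[OF I] by blast
    then have "f \<in> P" using subset_colon_ideal[OF I] f(1) by blast
    with P show "P \<in> {P \<in> height_one_primes R. f \<in> P}"
      using pure_height_one_assoc[OF q] by blast
  qed
  then show ?thesis
    by (rule finite_subset) (rule finite_height_one_primes_containing[OF I.Icarr[OF f(1)] f(2)])
qed

lemma ord_at_mem_ideal_power:
  assumes P: "P \<in> height_one_primes R" and I: "ideal I R" "I \<noteq> {\<zero>}"
    and z: "z \<in> ideal_power R I a" "z \<noteq> \<zero>"
  shows "a * ord_ideal R P I \<le> ord_at R P z"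
proof -
  interpret P: primeideal P R by (rule height_one_primeideal[OF P])
  interpret I: ideal I R by fact
  have zc: "z \<in> carrier R" using z(1) ideal.Icarr[OF ideal_ideal_power[OF I(1)]] by blast
  obtain g where g: "g \<in> I" "g \<noteq> \<zero>" "ord_at R P g = ord_ideal R P I"
    using ord_ideal_attained[OF I] by blast
  have gc: "g \<in> carrier R" using g(1) by (rule I.Icarr)
  have "local_dvd R P g x" if x: "x \<in> I" for x
  proof (cases "x = \<zero>")
    case True
    then show ?thesis using P.dvd_imp_local_dvd[of \<zero> g] gc by simp
  next
    case False
    then show ?thesis
      using ord_ideal_le[OF x, of P] ord_at_le_iff[OF P gc g(2) I.Icarr[OF x]] g(3) by simp
  qed
  then have "local_dvd R P (g [^] a) z"
    by (rule ideal_power_local_dvd[OF P.primeideal I(1) gc _ z(1)])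
  then have "ord_at R P (g [^] a) \<le> ord_at R P z"
    using ord_at_le_iff[OF P _ _ zc z(2), of "g [^] a"] gc g(2) nat_pow_nonzero by simp
  then show ?thesis using g(3) ord_at_pow[OF P gc g(2)] by simp
qed

text \<open>A multiplier s outside all associated primes has order 0 there, so sf and f have equal
  orders. Conversely, an element g of least order at P gives an s outside P, depending on P, with sf
  in (g^a). Thus (I^a : f) is contained in no associated prime, and prime avoidance provides one s
  for all of them.\<close>

lemma mem_symbolic_power_iff:
  assumes q: "pure_height R I 1" and f: "f \<in> carrier R" "f \<noteq> \<zero>"
  shows "f \<in> symbolic_power R I a \<longleftrightarrow>
    (\<forall>P\<in>assoc_primes R I. a * ord_ideal R P I \<le> ord_at R P f)"
proof (cases "a = 0")
  case True
  then show ?thesis using f by (simp add: symbolic_power_def)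
next
  case False
  have I: "ideal I R" using q by (simp add: pure_height_def)
  interpret I: ideal I R by fact
  have nz: "I \<noteq> {\<zero>}" by (rule pure_height_one_nonzero[OF q])
  have height: "P \<in> height_one_primes R" if "P \<in> assoc_primes R I" for P
    using that pure_height_one_assoc[OF q] by blast
  have Ia: "ideal (ideal_power R I a) R" by (rule ideal_ideal_power[OF I])
  have sym: "f \<in> symbolic_power R I a \<longleftrightarrow>
      (\<exists>s\<in>colon_ideal R (ideal_power R I a) f. \<forall>P\<in>assoc_primes R I. s \<notin> P)"
    using False f by (auto simp: symbolic_power_def colon_ideal_def)
  show ?thesis
    unfolding sym
  proof (intro iffI ballI)
    fix P assume "\<exists>s\<in>colon_ideal R (ideal_power R I a) f. \<forall>P\<in>assoc_primes R I. s \<notin> P"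
      and P: "P \<in> assoc_primes R I"
    then obtain s where s: "s \<in> carrier R" "s \<otimes> f \<in> ideal_power R I a" "s \<notin> P"
      by (auto simp: colon_ideal_def)
    interpret P: primeideal P R by (rule height_one_primeideal[OF height[OF P]])
    have "s \<noteq> \<zero>" using s(3) P.zero_closed by blast
    then have "s \<otimes> f \<noteq> \<zero>" using s(1) f integral_iff by simp
    then have "a * ord_ideal R P I \<le> ord_at R P (s \<otimes> f)"
      by (rule ord_at_mem_ideal_power[OF height[OF P] I nz s(2)])
    also have "\<dots> = ord_at R P f"
      using ord_at_mult[OF height[OF P] s(1) \<open>s \<noteq> \<zero>\<close> f]
        ord_at_eq_0_iff[OF height[OF P] s(1) \<open>s \<noteq> \<zero>\<close>] s(3) by simp
    finally show "a * ord_ideal R P I \<le> ord_at R P f" .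
  next
    assume le: "\<forall>P\<in>assoc_primes R I. a * ord_ideal R P I \<le> ord_at R P f"
    show "\<exists>s\<in>colon_ideal R (ideal_power R I a) f. \<forall>P\<in>assoc_primes R I. s \<notin> P"
    proof (rule prime_avoidance)
      show "ideal (colon_ideal R (ideal_power R I a) f) R" by (rule ideal_colon_ideal[OF Ia f(1)])
      show "finite (assoc_primes R I)" by (rule finite_assoc_primes[OF q])
      show "primeideal P R" if "P \<in> assoc_primes R I" for P
        using height_one_primeideal[OF height[OF that]] .
      show "P = Q" if "P \<in> assoc_primes R I" "Q \<in> assoc_primes R I" "P \<subseteq> Q" for P Q
        using height_one_subset_eq[OF height height] that by blast
      fix P assume P: "P \<in> assoc_primes R I"
      obtain g where g: "g \<in> I" "g \<noteq> \<zero>" "ord_at R P g = ord_ideal R P I"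
        using ord_ideal_attained[OF I nz] by blast
      have gc: "g \<in> carrier R" using g(1) by (rule I.Icarr)
      have "ord_at R P (g [^] a) \<le> ord_at R P f"
        using le P by (simp add: ord_at_pow[OF height[OF P] gc g(2)] g(3))
      then have "local_dvd R P (g [^] a) f"
        using ord_at_le_iff[OF height[OF P] _ _ f, of "g [^] a"] gc g(2) nat_pow_nonzero by simp
      then obtain s r where s: "s \<in> carrier R" "s \<notin> P" "r \<in> carrier R" "s \<otimes> f = r \<otimes> g [^] a"
        by (auto simp: local_dvd_def)
      have "r \<otimes> g [^] a \<in> ideal_power R I a"
        by (rule ideal.I_l_closed[OF Ia nat_pow_mem_ideal_power[OF g(1) gc] s(3)])
      then have "s \<in> colon_ideal R (ideal_power R I a) f"
        using s(1) unfolding colon_ideal_def by (simp only: s(4) mem_Collect_eq)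
      with s(2) show "\<not> colon_ideal R (ideal_power R I a) f \<subseteq> P" by blast
    qed
  qed
qed

text \<open>By the criterion on orders, the symbolic power is the intersection of the ideals
  \<open>symbolic_power R P (a * ord_ideal R P I)\<close> over the associated primes P. Zero needs
  its own check, since the criterion covers nonzero elements only.\<close>

lemma ideal_symbolic_power:
  assumes q: "pure_height R I 1"
  shows "ideal (symbolic_power R I a) R"
proof -
  have I: "ideal I R" using q by (simp add: pure_height_def)
  let ?S = "\<lambda>P. symbolic_power R P (a * ord_ideal R P I)"
  have ideals: "ideal (?S P) R" if "P \<in> assoc_primes R I" for P
    using that pure_height_one_assoc[OF q] ideal_symbolic_power_prime by blast
  have zero: "\<zero> \<in> symbolic_power R I a"
  proof -
    have "\<one> \<notin> P" if "P \<in> assoc_primes R I" for P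
      using that assoc_primes_iff[OF I] primeideal.one_notin by blast
    moreover have "\<zero> \<in> ideal_power R I a"
      by (intro additive_subgroup.zero_closed ideal.axioms(1) ideal_ideal_power I)
    ultimately show ?thesis by (auto simp: symbolic_power_def intro!: bexI[of _ \<one>])
  qed
  have "f \<in> symbolic_power R I a \<longleftrightarrow> f \<in> \<Inter>(insert (carrier R) (?S ` assoc_primes R I))" for f
  proof (cases "f \<in> carrier R - {\<zero>}")
    case True
    then have "f \<in> symbolic_power R I a \<longleftrightarrow> (\<forall>P\<in>assoc_primes R I. f \<in> ?S P)"
      using mem_symbolic_power_iff[OF q] mem_symbolic_power_prime_iff pure_height_one_assoc[OF q]
      by blast
    then show ?thesis using True by simp
  next
    case False
    then show ?thesis
    proof (cases "f = \<zero>")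
      case True
      have "\<zero> \<in> ?S P" if "P \<in> assoc_primes R I" for P
        by (intro additive_subgroup.zero_closed ideal.axioms(1) ideals that)
      with True zero show ?thesis by simp
    next
      assume "f \<noteq> \<zero>"
      with False show ?thesis by (auto simp: symbolic_power_def split: if_splits)
    qed
  qed
  \<comment> \<open>Inserting \<open>carrier R\<close> makes the family visibly nonempty, as the
    rule for intersections of ideals demands.\<close>
  then have "symbolic_power R I a = \<Inter>(insert (carrier R) (?S ` assoc_primes R I))" by blast
  also have "ideal \<dots> R"
    by (rule i_Intersect) (use ideals oneideal in auto)
  finally show ?thesis .
qed

text \<open>Multiplying by d^m raises the order at each associated prime P by exactly D m e_P.
  Conversely, an f in the left side has at least the order of d^m at every height one prime, so d^m
  divides f in R, and subtracting orders puts the quotient into the s-th symbolic power.\<close>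

lemma symbolic_power_add_mult:
  assumes q: "pure_height R I 1" and d: "d \<in> carrier R" "d \<noteq> \<zero>"
    and ord: "\<And>P. P \<in> height_one_primes R \<Longrightarrow>
      ord_at R P d = D * (if P \<in> assoc_primes R I then ord_ideal R P I else 0)"
  shows "symbolic_power R I (D * m + s) = (PIdl (d [^] m)) \<cdot> symbolic_power R I s"
proof
  have height: "P \<in> height_one_primes R" if "P \<in> assoc_primes R I" for P
    using that pure_height_one_assoc[OF q] by blast
  have dm: "d [^] m \<in> carrier R" "d [^] m \<noteq> \<zero>" using d nat_pow_nonzero by auto
  have ord_dm: "ord_at R P (d [^] m) = D * m * ord_ideal R P I" if "P \<in> assoc_primes R I" for P
    using ord_at_pow[OF height[OF that] d, of m] ord[OF height[OF that]] that by simp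
  have zero: "\<zero> \<in> symbolic_power R I a" for a
    by (intro additive_subgroup.zero_closed ideal.axioms(1) ideal_symbolic_power q)
  show "(PIdl (d [^] m)) \<cdot> symbolic_power R I s \<subseteq> symbolic_power R I (D * m + s)"
  proof (rule ideal_prod_subset[OF ideal_symbolic_power[OF q]])
    fix i j assume i: "i \<in> PIdl (d [^] m)" and j: "j \<in> symbolic_power R I s"
    have jc: "j \<in> carrier R" using j by (rule ideal.Icarr[OF ideal_symbolic_power[OF q]])
    obtain r where r: "r \<in> carrier R" "i = r \<otimes> d [^] m" using i unfolding cgenideal_def by blast
    show "i \<otimes> j \<in> symbolic_power R I (D * m + s)"
    proof (cases "i \<otimes> j = \<zero>")
      case True
      then show ?thesis using zero by simp
    next
      case False
      have ic: "i \<in> carrier R" using r dm by simp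
      with False jc have nz: "i \<noteq> \<zero>" "j \<noteq> \<zero>" by auto
      have "(D * m + s) * ord_ideal R P I \<le> ord_at R P (i \<otimes> j)" if P: "P \<in> assoc_primes R I" for P
      proof -
        have "s * ord_ideal R P I \<le> ord_at R P j"
          using j mem_symbolic_power_iff[OF q jc nz(2)] P by blast
        moreover have "r \<noteq> \<zero>" using nz(1) r dm by auto
        then have "D * m * ord_ideal R P I \<le> ord_at R P i"
          using r dm ord_at_mult[OF height[OF P] r(1) _ dm] ord_dm[OF P] by simp
        ultimately show ?thesis
          using ord_at_mult[OF height[OF P] ic nz(1) jc nz(2)] by (simp add: add_mult_distrib)
      qed
      then show ?thesis using mem_symbolic_power_iff[OF q _ False] ic jc by simp
    qed
  qed
  show "symbolic_power R I (D * m + s) \<subseteq> (PIdl (d [^] m)) \<cdot> symbolic_power R I s"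
  proof
    fix f assume f: "f \<in> symbolic_power R I (D * m + s)"
    have fc: "f \<in> carrier R" using f by (rule ideal.Icarr[OF ideal_symbolic_power[OF q]])
    show "f \<in> (PIdl (d [^] m)) \<cdot> symbolic_power R I s"
    proof (cases "f = \<zero>")
      case True
      have "ideal ((PIdl (d [^] m)) \<cdot> symbolic_power R I s) R"
        by (intro ideal_prod_is_ideal cgenideal_ideal ideal_symbolic_power dm q)
      then show ?thesis
        using True by (simp add: additive_subgroup.zero_closed ideal.axioms(1))
    next
      case False
      have le: "(D * m + s) * ord_ideal R P I \<le> ord_at R P f" if "P \<in> assoc_primes R I" for P
        using that f mem_symbolic_power_iff[OF q fc False] by blast
      have "f \<in> PIdl (d [^] m)"
        unfolding mem_cgenideal_iff_ord_at[OF dm fc False]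
      proof
        fix P assume P: "P \<in> height_one_primes R"
        show "ord_at R P (d [^] m) \<le> ord_at R P f"
        proof (cases "P \<in> assoc_primes R I")
          case True
          then show ?thesis using le[OF True] by (simp add: ord_dm add_mult_distrib)
        next
          \<comment> \<open>Away from the associated primes nothing is known about f; it matters
            that d has order 0 there.\<close>
          case False
          then show ?thesis using ord[OF P] ord_at_pow[OF P d] by simp
        qed
      qed
      then obtain g where g: "g \<in> carrier R" "f = g \<otimes> d [^] m" unfolding cgenideal_def by blast
      then have "g \<noteq> \<zero>" using False dm by auto
      have "s * ord_ideal R P I \<le> ord_at R P g" if P: "P \<in> assoc_primes R I" for P
        using le[OF P] ord_at_mult[OF height[OF P] g(1) \<open>g \<noteq> \<zero>\<close> dm] ord_dm[OF P] g(2)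
        by (simp add: add_mult_distrib)
      then have "g \<in> symbolic_power R I s"
        using mem_symbolic_power_iff[OF q g(1) \<open>g \<noteq> \<zero>\<close>] by blast
      then have "d [^] m \<otimes> g \<in> (PIdl (d [^] m)) \<cdot> symbolic_power R I s"
        by (intro ideal_prod.prod cgenideal_self dm)
      then show ?thesis using g dm by (simp add: m_comm)
    qed
  qed
qed

section \<open>Principal divisors\<close>

text \<open>A weak form of the approximation theorem: lower bounds on \<open>F\<close>, but an exact
  order only at the single prime Q. This is enough because the order of a generator is determined
  one prime at a time.\<close>

lemma exists_prescribed_ord_at:
  assumes "finite F" "F \<subseteq> height_one_primes R" and Q: "Q \<in> height_one_primes R"
  shows "\<exists>f\<in>carrier R. f \<noteq> \<zero> \<and> (\<forall>P\<in>F. a P \<le> ord_at R P f) \<and>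
    ord_at R Q f = (if Q \<in> F then a Q else 0)"
  using assms(1,2)
proof (induction F)
  case empty
  then show ?case using ord_at_one[OF Q] by (intro bexI[of _ \<one>]) auto
next
  case (insert P F)
  then obtain f where f: "f \<in> carrier R" "f \<noteq> \<zero>" "\<forall>P\<in>F. a P \<le> ord_at R P f"
    "ord_at R Q f = (if Q \<in> F then a Q else 0)" by auto
  have P: "P \<in> height_one_primes R" using insert.prems by simp
  \<comment> \<open>Either p has order 1 at Q = P, or it lies in P outside Q. So the factor
    \<open>p [^] a P\<close> contributes \<open>a P\<close> at Q or nothing.\<close>
  obtain p where p: "p \<in> carrier R" "p \<noteq> \<zero>" "1 \<le> ord_at R P p"
    "ord_at R Q p = (if P = Q then 1 else 0)"
  proof (cases "P = Q")
    case True
    then show thesis using that exists_ord_at_eq_1[OF Q] by auto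
  next
    case False
    then have "\<not> P \<subseteq> Q" using height_one_subset_eq[OF P Q] by blast
    then obtain p where p: "p \<in> P" "p \<notin> Q" by blast
    have pc: "p \<in> carrier R"
      using p(1) by (rule ideal.Icarr[OF primeideal.axioms(1)[OF height_one_primeideal[OF P]]])
    have "p \<noteq> \<zero>"
      using p(2) primeideal.axioms(1)[OF height_one_primeideal[OF Q]]
      by (auto simp: additive_subgroup.zero_closed ideal.axioms(1))
    moreover have "ord_at R P p \<noteq> 0" "ord_at R Q p = 0"
      using p ord_at_eq_0_iff[OF P pc \<open>p \<noteq> \<zero>\<close>] ord_at_eq_0_iff[OF Q pc \<open>p \<noteq> \<zero>\<close>] by auto
    ultimately show thesis using that[of p] pc False by simp
  qed
  let ?g = "p [^] a P \<otimes> f"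
  have pa: "p [^] a P \<in> carrier R" "p [^] a P \<noteq> \<zero>" using p nat_pow_nonzero by auto
  have ord: "ord_at R P' ?g = a P * ord_at R P' p + ord_at R P' f" if "P' \<in> height_one_primes R" for P'
    using ord_at_mult[OF that pa f(1,2)] ord_at_pow[OF that p(1,2)] by simp
  have "a P \<le> ord_at R P ?g" using p(3) by (simp add: ord[OF P] trans_le_add1)
  moreover have "a P' \<le> ord_at R P' ?g" if "P' \<in> F" for P'
  proof -
    have "P' \<in> height_one_primes R" using that insert.prems by auto
    then show ?thesis using that f(3) by (simp add: ord trans_le_add2)
  qed
  moreover have "ord_at R Q ?g = (if Q \<in> insert P F then a Q else 0)"
    using ord[OF Q] p(4) f(4) insert.hyps(2) by auto
  moreover have "?g \<noteq> \<zero>" using pa f integral_iff by simp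
  ultimately show ?case using pa f by (intro bexI[of _ ?g]) auto
qed

text \<open>Let f generate the intersection J. Membership of f in J bounds its orders from below.
  For equality at Q, take g in J of exact order at Q: it is a multiple of f, which also shows f
  \<noteq> 0.\<close>

lemma principal_divisor_ord_at:
  assumes c: "c \<in> principal_divisors R"
  shows "\<exists>f\<in>carrier R. f \<noteq> \<zero> \<and>
    (\<forall>P\<in>height_one_primes R. int (ord_at R P f) = Poly_Mapping.lookup c P)"
proof -
  let ?F = "Poly_Mapping.keys c" and ?a = "\<lambda>P. nat (Poly_Mapping.lookup c P)"
  define J where "J = carrier R \<inter> (\<Inter>P\<in>?F. symbolic_power R P (?a P))"
  have F: "finite ?F" "?F \<subseteq> height_one_primes R" and pos: "\<And>P. P \<in> ?F \<Longrightarrow> 0 < Poly_Mapping.lookup c P"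
    and princ: "principalideal J R"
    using c by (auto simp: principal_divisors_def J_def)
  obtain f where f: "f \<in> carrier R" "J = PIdl f"
    using principalideal.generate[OF princ] cgenideal_eq_genideal by metis
  have mem: "g \<in> J \<longleftrightarrow> (\<forall>P\<in>?F. ?a P \<le> ord_at R P g)" if "g \<in> carrier R" "g \<noteq> \<zero>" for g
    using that F(2) by (auto simp: J_def mem_symbolic_power_prime_iff subset_iff)
  have mem_f: "f \<in> J" unfolding f(2) by (rule cgenideal_self[OF f(1)])
  have *: "f \<noteq> \<zero> \<and> int (ord_at R Q f) = Poly_Mapping.lookup c Q" if Q: "Q \<in> height_one_primes R" for Q
  proof -
    obtain g where g: "g \<in> carrier R" "g \<noteq> \<zero>" "\<forall>P\<in>?F. ?a P \<le> ord_at R P g"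
      "ord_at R Q g = (if Q \<in> ?F then ?a Q else 0)"
      using exists_prescribed_ord_at[OF F Q, of ?a] by blast
    have gJ: "g \<in> PIdl f" using mem[OF g(1,2)] g(3) f(2) by blast
    then have "f \<noteq> \<zero>" using g(2) by (auto simp: cgenideal_def)
    then have "ord_at R Q f \<le> ord_at R Q g" using gJ mem_cgenideal_iff_ord_at[OF f(1) _ g(1,2)] Q by blast
    moreover have "?a Q \<le> ord_at R Q f" if "Q \<in> ?F"
      using that mem[OF f(1) \<open>f \<noteq> \<zero>\<close>] mem_f by blast
    ultimately have "ord_at R Q f = (if Q \<in> ?F then ?a Q else 0)" using g(4) by auto
    with \<open>f \<noteq> \<zero>\<close> pos[of Q] show ?thesis
      by (cases "Poly_Mapping.lookup c Q = 0") (simp_all add: in_keys_iff)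
  qed
  \<comment> \<open>The proof that f \<noteq> 0 started from a height one prime; if there is none,
    the element 1 serves.\<close>
  show ?thesis
  proof (cases "height_one_primes R = {}")
    case True
    then show ?thesis using one_closed one_not_zero by blast
  next
    case False
    with * f(1) show ?thesis by blast
  qed
qed

text \<open>The generators have positive coefficients only, while the subgroup also contains their
  negatives. The pair f, g represents the fraction f/g whose divisor is c.\<close>

lemma generate_principal_divisors_ord_at:
  assumes "c \<in> generate (free_Abelian_group (height_one_primes R)) (principal_divisors R)"
  shows "\<exists>f g. f \<in> carrier R \<and> f \<noteq> \<zero> \<and> g \<in> carrier R \<and> g \<noteq> \<zero> \<and>
    (\<forall>P\<in>height_one_primes R. int (ord_at R P f) = int (ord_at R P g) + Poly_Mapping.lookup c P)"
  using assms
proof (induction c rule: generate.induct)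
  case one
  show ?case by (intro exI[of _ \<one>]) simp
next
  case (incl h)
  then obtain f where "f \<in> carrier R" "f \<noteq> \<zero>"
    "\<forall>P\<in>height_one_primes R. int (ord_at R P f) = Poly_Mapping.lookup h P"
    using principal_divisor_ord_at by blast
  then show ?case by (intro exI[of _ f] exI[of _ \<one>]) (simp add: ord_at_one)
next
  case (inv h)
  then have "Poly_Mapping.keys h \<subseteq> height_one_primes R" by (simp add: principal_divisors_def)
  then have h: "inv\<^bsub>free_Abelian_group (height_one_primes R)\<^esub> h = - h" by simp
  obtain f where "f \<in> carrier R" "f \<noteq> \<zero>"
    "\<forall>P\<in>height_one_primes R. int (ord_at R P f) = Poly_Mapping.lookup h P"
    using inv principal_divisor_ord_at by blast
  then show ?case unfolding h by (intro exI[of _ \<one>] exI[of _ f]) (simp add: ord_at_one)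
next
  case (eng c1 c2)
  then obtain f1 g1 f2 g2 where
    1: "f1 \<in> carrier R" "f1 \<noteq> \<zero>" "g1 \<in> carrier R" "g1 \<noteq> \<zero>"
      "\<forall>P\<in>height_one_primes R. int (ord_at R P f1) = int (ord_at R P g1) + Poly_Mapping.lookup c1 P" and
    2: "f2 \<in> carrier R" "f2 \<noteq> \<zero>" "g2 \<in> carrier R" "g2 \<noteq> \<zero>"
      "\<forall>P\<in>height_one_primes R. int (ord_at R P f2) = int (ord_at R P g2) + Poly_Mapping.lookup c2 P"
    by blast
  show ?case
    by (intro exI[of _ "f1 \<otimes> f2"] exI[of _ "g1 \<otimes> g2"])
      (use 1 2 in \<open>simp add: ord_at_mult lookup_add integral_iff\<close>)
qed

text \<open>The D-fold multiple of the divisor c with coefficients \<open>n P\<close> is zero in the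
  class group, so it is the divisor of a fraction f/g. Its coefficients are nonnegative, so f has at
  least the order of g everywhere; hence g divides f in R, and d = f/g.\<close>

lemma exists_ord_at_eq_mult:
  assumes ann: "\<forall>x \<in> carrier (divisor_class_group R).
      x [^]\<^bsub>divisor_class_group R\<^esub> D = \<one>\<^bsub>divisor_class_group R\<^esub>"
    and F: "finite F" "F \<subseteq> height_one_primes R"
  shows "\<exists>d\<in>carrier R. d \<noteq> \<zero> \<and>
    (\<forall>P\<in>height_one_primes R. ord_at R P d = D * (if P \<in> F then n P else 0))"
proof -
  let ?G = "free_Abelian_group (height_one_primes R)"
  let ?N = "generate ?G (principal_divisors R)"
  interpret G: comm_group ?G by (rule abelian_free_Abelian_group)
  have sub: "subgroup ?N ?G"
    by (rule G.generate_is_subgroup) (auto simp: principal_divisors_def)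
  then interpret N: normal ?N ?G by (rule G.subgroup_imp_normal)
  define c where "c = Abs_poly_mapping (\<lambda>P. if P \<in> F then int (n P) else 0)"
  have "finite {P. (if P \<in> F then int (n P) else 0) \<noteq> 0}"
    using F(1) by (rule rev_finite_subset) (auto split: if_splits)
  then have lookup: "Poly_Mapping.lookup c = (\<lambda>P. if P \<in> F then int (n P) else 0)"
    unfolding c_def by (rule lookup_Abs_poly_mapping)
  have "Poly_Mapping.keys c \<subseteq> F" by (auto simp: in_keys_iff lookup split: if_splits)
  with F(2) have c: "c \<in> carrier ?G" by auto
  then have "?N #>\<^bsub>?G\<^esub> c \<in> carrier (divisor_class_group R)"
    unfolding divisor_class_group_def carrier_FactGroup by blast
  with ann have "(?N #>\<^bsub>?G\<^esub> c) [^]\<^bsub>?G Mod ?N\<^esub> D = ?N"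
    by (simp add: divisor_class_group_def)
  then have "?N #>\<^bsub>?G\<^esub> (c [^]\<^bsub>?G\<^esub> D) = ?N" by (simp only: N.FactGroup_pow[OF c])
  then have "c [^]\<^bsub>?G\<^esub> D \<in> ?N"
    using G.rcos_self[OF G.nat_pow_closed[OF c, of D] sub] by metis
  \<comment> \<open>The power in the multiplicatively written free abelian group is the multiple by
    D of the formal sum.\<close>
  then have "frag_cmul (int D) c \<in> ?N" by simp
  then obtain f g where f: "f \<in> carrier R" "f \<noteq> \<zero>" and g: "g \<in> carrier R" "g \<noteq> \<zero>"
    and ord: "\<And>P. P \<in> height_one_primes R \<Longrightarrow>
      int (ord_at R P f) = int (ord_at R P g) + int D * (if P \<in> F then int (n P) else 0)"
    using generate_principal_divisors_ord_at[of "frag_cmul (int D) c"] by (auto simp: lookup)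
  have eq: "ord_at R P f = ord_at R P g + D * (if P \<in> F then n P else 0)" if "P \<in> height_one_primes R" for P
    using ord[OF that] by (cases "P \<in> F") (simp_all flip: of_nat_mult of_nat_add)
  then have "f \<in> PIdl g" using mem_cgenideal_iff_ord_at[OF g f] by simp
  then obtain d where d: "d \<in> carrier R" "f = d \<otimes> g" unfolding cgenideal_def by blast
  then have "d \<noteq> \<zero>" using f g by auto
  moreover have "ord_at R P d = D * (if P \<in> F then n P else 0)" if "P \<in> height_one_primes R" for P
    using eq[OF that] ord_at_mult[OF that d(1) \<open>d \<noteq> \<zero>\<close> g] d(2) by simp
  ultimately show ?thesis using d(1) by blast
qed

end

theorem lemma1p1:
  fixes R :: "('a, 'b) ring_scheme" and D :: nat
  assumes "noetherian_domain R" and "normal_domain R" and "0 < krull_dim R"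
    and "0 < D"
    and "\<forall>x \<in> carrier (divisor_class_group R).
           x [^]\<^bsub>divisor_class_group R\<^esub> D = \<one>\<^bsub>divisor_class_group R\<^esub>"
  shows "\<forall>(\<qq> :: 'a set) (r :: nat) (s :: nat). pure_height R \<qq> 1 \<and> 0 < r \<and> s < D \<longrightarrow>
           symbolic_power R \<qq> (D * (r - 1) + s) =
             ideal_power R (symbolic_power R \<qq> D) (r - 1) \<cdot>\<^bsub>R\<^esub> symbolic_power R \<qq> s
           \<and> symbolic_power R \<qq> (D * (r - 1) + 1) \<subseteq> ideal_power R \<qq> r"
proof (intro allI impI)
  interpret noetherian_normal_domain R
    by (intro noetherian_normal_domain.intro noetherian_normal_domain_axioms.intro assms)
  fix \<qq> and r s :: nat
  assume "pure_height R \<qq> 1 \<and> 0 < r \<and> s < D"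
  then have q: "pure_height R \<qq> 1" and r: "0 < r" by auto
  have I: "ideal \<qq> R" using q by (simp add: pure_height_def)
  obtain d where d: "d \<in> carrier R" "d \<noteq> \<zero>\<^bsub>R\<^esub>" and ord: "\<And>P. P \<in> height_one_primes R \<Longrightarrow>
      ord_at R P d = D * (if P \<in> assoc_primes R \<qq> then ord_ideal R P \<qq> else 0)"
    using exists_ord_at_eq_mult[OF assms(5) finite_assoc_primes[OF q] pure_height_one_assoc[OF q],
        of "\<lambda>P. ord_ideal R P \<qq>"] by blast
  note add_mult = symbolic_power_add_mult[OF q d ord]

  \<comment> \<open>The instance m = 1, s = 0, where the convention that the zeroth symbolic power
    is R removes the second factor.\<close>
  have "symbolic_power R \<qq> D = PIdl\<^bsub>R\<^esub> d"
    using add_mult[of 1 0] d ideal_prod_one[OF cgenideal_ideal[OF d(1)]]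
    by (simp add: symbolic_power_def)
  then have pow: "ideal_power R (symbolic_power R \<qq> D) m = PIdl\<^bsub>R\<^esub> (d [^]\<^bsub>R\<^esub> m)" for m
    using ideal_power_cgenideal[OF d(1)] by simp
  have "d \<in> \<qq>"
    using symbolic_power_subset[OF I assms(4)] cgenideal_self[OF d(1)]
      \<open>symbolic_power R \<qq> D = PIdl\<^bsub>R\<^esub> d\<close> by blast
  then have "PIdl\<^bsub>R\<^esub> (d [^]\<^bsub>R\<^esub> (r - 1)) \<subseteq> ideal_power R \<qq> (r - 1)"
    by (intro cgenideal_minimal ideal_ideal_power nat_pow_mem_ideal_power I d)
  moreover have "symbolic_power R \<qq> 1 \<subseteq> \<qq>" by (rule symbolic_power_subset[OF I]) simp
  \<comment> \<open>The r factors of the ideal power arise as r - 1 copies of d and one first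
    symbolic power. For D = 1 the exponent s = 1 equals D, which \<open>add_mult\<close> still
    covers.\<close>
  ultimately have "(PIdl\<^bsub>R\<^esub> (d [^]\<^bsub>R\<^esub> (r - 1))) \<cdot>\<^bsub>R\<^esub> symbolic_power R \<qq> 1
      \<subseteq> ideal_power R \<qq> (Suc (r - 1))"
    unfolding ideal_power_Suc
    by (intro ideal_prod_subset ideal_prod_is_ideal ideal_ideal_power I) (blast intro: ideal_prod.prod)
  then have "symbolic_power R \<qq> (D * (r - 1) + 1) \<subseteq> ideal_power R \<qq> (Suc (r - 1))"
    by (simp only: add_mult)
  then show "symbolic_power R \<qq> (D * (r - 1) + s) =
        ideal_power R (symbolic_power R \<qq> D) (r - 1) \<cdot>\<^bsub>R\<^esub> symbolic_power R \<qq> s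
      \<and> symbolic_power R \<qq> (D * (r - 1) + 1) \<subseteq> ideal_power R \<qq> r"
    using add_mult[of "r - 1" s] pow r by simp
qed

end
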